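(* Let $(M,F)$ be an $n$-dimensional $C^0$-Finsler manifold which is strongly convex with respect to a Finsler structure $\check F$ and consider an open subset $U\subset M$. Suppose that there exist a local trivialization $\tau:TU\to U\times\mathbb R^n$ and a coordinate system $\phi:U\to\mathbb R^n$ such that, with $\tau_\phi=(\phi\times\mathrm{id})\circ\tau$, the function $F_{\tau_\phi}=F\circ(\tau_\phi)^{-1}$ is a horizontally $C^2$ family of asymmetric norms and $d_hF^2_{\tau_\phi}$ is locally Lipschitz. Then the extended geodesic field $\mathcal E$ of $(U,F)$ is a locally Lipschitz vector field on $T^*U\backslash 0$.
   Context: An asymmetric norm on a finite dimensional real vector space $V$ is a function $F:V\to[0,\infty)$ with $F(y)=0$ iff $y=0$, $F(\lambda y)=\lambda F(y)$ for $\lambda>0$, and $F(y_1+y_2)\le F(y_1)+F(y_2)$. A $C^0$-Finsler structure on a $C^\infty$ manifold $M$ is a continuous $F:TM\to[0,\infty)$ such that each $F(x,\cdot)$ is an asymmetric norm; $S_F[x,0,1]=\{y\in T_xM:F(x,y)=1\}$. A Finsler structure is a $C^0$-Finsler structure that is $C^\infty$ on $TM\backslash0$ with $\frac12\frac{\partial^2F^2}{\partial y^i\partial y^j}$ positive definite there. $F$ is strongly convex with respect to $\check F$ if $F^2(x,z)\ge F^2(x,y)+\alpha(z-y)+\check F^2(x,z-y)$ for all $x\in M$, $y,z\in T_xM$, $\alpha\in\partial F^2(x,y)$, where $\partial F^2(x,y)$ is the subdifferential of $F(x,\cdot)^2$ at $y$. Local trivializations are smooth vector bundle trivializations (fiberwise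 linear). For $W\subset\mathbb R^n$ open, a continuous $G:W\times\mathbb R^n\to\mathbb R$ is a horizontally $C^1$ family of asymmetric norms if every $G(x,\cdot)$ is an asymmetric norm and each $\frac{\partial G}{\partial x^i}$ is continuous on $W\times\mathbb R^n$; it is horizontally $C^2$ if moreover each $\frac{\partial^2G}{\partial x^i\partial x^j}:W\times(\mathbb R^n\backslash\{0\})\to\mathbb R$ is continuous. $d_hG^2:W\times\mathbb R^n\to\mathbb R^{n*}$ is $d_hG^2(x,y)=\sum_i\frac{\partial G^2}{\partial x^i}(x,y)dx^i$. Pontryagin type: $(M,F)$ is of Pontryagin type at $p$ if there are a neighborhood of $p$, coordinates $(x^1,\dots,x^n)$ on it, and a family of $C^1$ unit vector fields $X_u(x)=(f^1(x,u),\dots,f^n(x,u))$, $u\in S^{n-1}$ (Euclidean unit sphere), such that (1) for each $x$, $u\mapsto X_u(x)$ is a homeomorphism of $S^{n-1}$ onto $S_F[x,0,1]$; (2) $(x,u)\mapsto(f^1,\dots,f^n)(x,u)$ is continuous; (3) $(x,u)\mapsto(\frac{\partial f^1}{\partial x^i},\dots,\frac{\partial f^n}{\partial x^i})(x,u)$ is continuous for each $i$. A $C^0$-Finsler structure represented in a coordinate system $\tau_\phi$ as a horizontally $C^1$ family is of Pontryagin type (take the vector fields with constant coordinates $u\in S^{n-1}$ in the trivialization, divided by their $F$-norm). Extended geodesic field: with $H_u(x,\alpha)=\alpha(X_u(x))$ and, in natural coordinates $(x^i,\alpha_i)$ of the cotangent bundle, $$\vec H_u=\sum_if^i(x,u)\frac{\partial}{\partial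 x^i}-\sum_{i,j}\alpha_j\frac{\partial f^j}{\partial x^i}(x,u)\frac{\partial}{\partial\alpha_i},$$ $\mathcal E(x,\alpha)=\{\vec H_u(x,\alpha):u\in S^{n-1},\ H_u(x,\alpha)=\max_vH_v(x,\alpha)\}$ for $\alpha\neq0$ (independent of the coordinates and family chosen). $\mathcal E$ is a locally Lipschitz vector field if $\mathcal E(x,\alpha)$ is a single vector for every $(x,\alpha)$ and its components in coordinates are locally Lipschitz functions. *)

theory Defs
  imports "HOL-Analysis.Analysis" "HOL-Library.Function_Algebras"
begin

subsection \<open>Calculus on open sets\<close>

text \<open>For open \<open>S\<close> in a Euclidean space this is the class \<open>C\<^sup>k\<close>.\<close>

primrec Ck_on :: "nat \<Rightarrow> 'e::euclidean_space set \<Rightarrow> ('e \<Rightarrow> 'f::euclidean_space) \<Rightarrow> bool" where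
  "Ck_on 0 S f \<longleftrightarrow> continuous_on S f"
| "Ck_on (Suc k) S f \<longleftrightarrow> (\<forall>x\<in>S. f differentiable (at x)) \<and>
     (\<forall>v. Ck_on k S (\<lambda>x. frechet_derivative f (at x) v))"

definition smooth_on :: "'e::euclidean_space set \<Rightarrow> ('e \<Rightarrow> 'f::euclidean_space) \<Rightarrow> bool" where
  "smooth_on S f \<longleftrightarrow> (\<forall>k. Ck_on k S f)"

definition has_partial :: "'n::finite \<Rightarrow> (real^'n \<Rightarrow> real) \<Rightarrow> real^'n \<Rightarrow> bool" where
  "has_partial i f x \<longleftrightarrow> (\<lambda>t. f (x + t *\<^sub>R axis i 1)) differentiable (at 0)"

definition partial :: "'n::finite \<Rightarrow> (real^'n \<Rightarrow> real) \<Rightarrow> real^'n \<Rightarrow> real" where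
  "partial i f x = deriv (\<lambda>t. f (x + t *\<^sub>R axis i 1)) 0"

definition locally_lipschitz_on :: "'e::metric_space set \<Rightarrow> ('e \<Rightarrow> 'f::metric_space) \<Rightarrow> bool" where
  "locally_lipschitz_on S f \<longleftrightarrow> (\<forall>x\<in>S. \<exists>r>0. \<exists>L. L-lipschitz_on (ball x r \<inter> S) f)"


subsection \<open>Asymmetric norms, dual space and subdifferential\<close>

instantiation "fun" :: (type, real_vector) real_vector
begin

definition scaleR_fun :: "real \<Rightarrow> ('a \<Rightarrow> 'b) \<Rightarrow> 'a \<Rightarrow> 'b" where
  "scaleR_fun r f = (\<lambda>x. r *\<^sub>R f x)"

instance
  by standard (simp_all add: scaleR_fun_def plus_fun_def fun_eq_iff scaleR_add_right scaleR_add_left)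

end

definition asymmetric_norm :: "'v::real_vector set \<Rightarrow> ('v \<Rightarrow> real) \<Rightarrow> bool" where
  "asymmetric_norm V N \<longleftrightarrow>
     (\<forall>y\<in>V. N y \<ge> 0) \<and> (\<forall>y\<in>V. N y = 0 \<longleftrightarrow> y = 0) \<and>
     (\<forall>y\<in>V. \<forall>r>0. N (r *\<^sub>R y) = r * N y) \<and>
     (\<forall>y\<in>V. \<forall>z\<in>V. N (y + z) \<le> N y + N z)"

text \<open>Functionals on the subspace \<open>V\<close> are extended by \<open>0\<close> outside \<open>V\<close>, so that equality of
  functionals is equality of functions.\<close>

definition dual_space :: "'v::real_vector set \<Rightarrow> ('v \<Rightarrow> real) set" where
  "dual_space V = {\<alpha>. (\<forall>v\<in>V. \<forall>w\<in>V. \<alpha> (v + w) = \<alpha> v + \<alpha> w) \<and>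
     (\<forall>r. \<forall>v\<in>V. \<alpha> (r *\<^sub>R v) = r * \<alpha> v) \<and> (\<forall>v. v \<notin> V \<longrightarrow> \<alpha> v = 0)}"

definition subdifferential ::
  "'v::real_vector set \<Rightarrow> ('v \<Rightarrow> real) \<Rightarrow> 'v \<Rightarrow> ('v \<Rightarrow> real) set" where
  "subdifferential V f y = {\<alpha> \<in> dual_space V. \<forall>z\<in>V. f z \<ge> f y + \<alpha> (z - y)}"


subsection \<open>Manifolds, tangent and cotangent bundle\<close>

text \<open>A chart is a pair of a domain and a map; the values of the map outside the domain are
  irrelevant. A tangent vector is the family of its representations in all charts around its base
  point (set to \<open>0\<close> at the remaining index values), related by the derivatives of the
  transition maps.\<close>

type_synonym ('a, 'e) chart = "'a set \<times> ('a \<Rightarrow> 'e)"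
type_synonym ('a, 'e) tvec = "('a, 'e) chart \<Rightarrow> 'e"
type_synonym ('a, 'e) covec = "('a, 'e) tvec \<Rightarrow> real"

definition chart_inv :: "('a, 'e) chart \<Rightarrow> 'e \<Rightarrow> 'a" where
  "chart_inv c = the_inv_into (fst c) (snd c)"

definition chart_image :: "('a, 'e) chart \<Rightarrow> 'e set" where
  "chart_image c = snd c ` fst c"

definition transition :: "('a, 'e) chart \<Rightarrow> ('a, 'e) chart \<Rightarrow> 'e \<Rightarrow> 'e" where
  "transition c d = snd d \<circ> chart_inv c"

definition is_chart :: "('a::topological_space, 'e::euclidean_space) chart \<Rightarrow> bool" where
  "is_chart c \<longleftrightarrow> open (fst c) \<and> open (chart_image c) \<and>
     homeomorphism (fst c) (chart_image c) (snd c) (chart_inv c)"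

definition compatible :: "('a, 'e::euclidean_space) chart \<Rightarrow> ('a, 'e) chart \<Rightarrow> bool" where
  "compatible c d \<longleftrightarrow>
     smooth_on (snd c ` (fst c \<inter> fst d)) (transition c d) \<and>
     smooth_on (snd d ` (fst c \<inter> fst d)) (transition d c)"

text \<open>The manifold is the whole type \<open>'a\<close>, and \<open>A\<close> is its maximal smooth atlas.\<close>

definition smooth_manifold ::
  "('a::{t2_space, second_countable_topology}, 'e::euclidean_space) chart set \<Rightarrow> bool" where
  "smooth_manifold A \<longleftrightarrow> (\<forall>c\<in>A. is_chart c) \<and> (\<Union>c\<in>A. fst c) = UNIV \<and>
     (\<forall>c\<in>A. \<forall>d\<in>A. compatible c d) \<and>
     (\<forall>c. is_chart c \<and> (\<forall>d\<in>A. compatible c d) \<longrightarrow> c \<in> A)"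

definition tangent_space :: "('a, 'e::euclidean_space) chart set \<Rightarrow> 'a \<Rightarrow> ('a, 'e) tvec set" where
  "tangent_space A p = {v.
     (\<forall>c\<in>A. \<forall>d\<in>A. p \<in> fst c \<and> p \<in> fst d \<longrightarrow>
        v d = frechet_derivative (transition c d) (at (snd c p)) (v c)) \<and>
     (\<forall>c. \<not> (c \<in> A \<and> p \<in> fst c) \<longrightarrow> v c = 0)}"

text \<open>The tangent vector at \<open>p\<close> whose coordinates in the chart \<open>c\<close> are \<open>y\<close>.\<close>

definition coord_vector ::
  "('a, 'e::euclidean_space) chart set \<Rightarrow> ('a, 'e) chart \<Rightarrow> 'a \<Rightarrow> 'e \<Rightarrow> ('a, 'e) tvec" where
  "coord_vector A c p = the_inv_into (tangent_space A p) (\<lambda>v. v c)"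

definition tangent_bundle ::
  "('a, 'e::euclidean_space) chart set \<Rightarrow> 'a set \<Rightarrow> ('a \<times> ('a, 'e) tvec) set" where
  "tangent_bundle A U = Sigma U (tangent_space A)"

definition tangent_chart ::
  "('a, 'e::euclidean_space) chart set \<Rightarrow> ('a, 'e) chart \<Rightarrow> ('a \<times> ('a, 'e) tvec, 'e \<times> 'e) chart" where
  "tangent_chart A c = (tangent_bundle A (fst c), \<lambda>(p, v). (snd c p, v c))"

definition cotangent_bundle ::
  "('a, 'e::euclidean_space) chart set \<Rightarrow> 'a set \<Rightarrow> ('a \<times> ('a, 'e) covec) set" where
  "cotangent_bundle A U = (SIGMA p:U. dual_space (tangent_space A p))"

definition slit_cotangent_bundle ::
  "('a, 'e::euclidean_space) chart set \<Rightarrow> 'a set \<Rightarrow> ('a \<times> ('a, 'e) covec) set" where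
  "slit_cotangent_bundle A U = {(p, \<alpha>) \<in> cotangent_bundle A U. \<alpha> \<noteq> 0}"

definition covec_coords ::
  "('a, real^'n) chart set \<Rightarrow> ('a, real^'n) chart \<Rightarrow> 'a \<Rightarrow> ('a, real^'n) covec \<Rightarrow> real^'n" where
  "covec_coords A c p \<alpha> = (\<chi> i. \<alpha> (coord_vector A c p (axis i 1)))"

text \<open>Natural coordinates \<open>(x\<^sup>i, \<alpha>\<^sub>i)\<close>; the cotangent bundle is a manifold modelled on
  \<open>(real^'n) \<times> (real^'n)\<close>, with tangent spaces \<open>tangent_space (cotangent_atlas A)\<close>.\<close>

definition cotangent_chart ::
  "('a, real^'n) chart set \<Rightarrow> ('a, real^'n) chart \<Rightarrow>
     ('a \<times> ('a, real^'n) covec, (real^'n) \<times> (real^'n)) chart" where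
  "cotangent_chart A c =
     (cotangent_bundle A (fst c), \<lambda>(p, \<alpha>). (snd c p, covec_coords A c p \<alpha>))"

definition cotangent_atlas ::
  "('a, real^'n) chart set \<Rightarrow>
     ('a \<times> ('a, real^'n) covec, (real^'n) \<times> (real^'n)) chart set" where
  "cotangent_atlas A = cotangent_chart A ` A"

text \<open>A smooth diffeomorphism from \<open>TU\<close> onto \<open>U \<times> real^'n\<close> over \<open>U\<close> that is linear on the fibres.\<close>

definition local_trivialization ::
  "('a, real^'n) chart set \<Rightarrow> 'a set \<Rightarrow>
     ('a \<times> ('a, real^'n) tvec \<Rightarrow> 'a \<times> (real^'n)) \<Rightarrow> bool" where
  "local_trivialization A U \<tau> \<longleftrightarrow>
     bij_betw \<tau> (tangent_bundle A U) (U \<times> UNIV) \<and>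
     (\<forall>z\<in>tangent_bundle A U. fst (\<tau> z) = fst z) \<and>
     (\<forall>p\<in>U. \<forall>v\<in>tangent_space A p. \<forall>w\<in>tangent_space A p. \<forall>r s.
        snd (\<tau> (p, r *\<^sub>R v + s *\<^sub>R w)) = r *\<^sub>R snd (\<tau> (p, v)) + s *\<^sub>R snd (\<tau> (p, w))) \<and>
     (\<forall>c\<in>A. fst c \<subseteq> U \<longrightarrow>
        smooth_on (chart_image c \<times> UNIV)
          (map_prod (snd c) id \<circ> \<tau> \<circ> chart_inv (tangent_chart A c)) \<and>
        smooth_on (chart_image c \<times> UNIV)
          (snd (tangent_chart A c) \<circ> the_inv_into (tangent_bundle A U) \<tau> \<circ>
             map_prod (chart_inv c) id))"


subsection \<open>Finsler structures\<close>

definition C0_Finsler ::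
  "('a, real^'n) chart set \<Rightarrow> ('a \<times> ('a, real^'n) tvec \<Rightarrow> real) \<Rightarrow> bool" where
  "C0_Finsler A F \<longleftrightarrow>
     (\<forall>p. asymmetric_norm (tangent_space A p) (\<lambda>y. F (p, y))) \<and>
     (\<forall>c\<in>A. continuous_on (chart_image c \<times> UNIV) (F \<circ> chart_inv (tangent_chart A c)))"

definition Finsler ::
  "('a, real^'n) chart set \<Rightarrow> ('a \<times> ('a, real^'n) tvec \<Rightarrow> real) \<Rightarrow> bool" where
  "Finsler A F \<longleftrightarrow> C0_Finsler A F \<and>
     (\<forall>c\<in>A. let F\<^sub>c = F \<circ> chart_inv (tangent_chart A c) in
        smooth_on (chart_image c \<times> (UNIV - {0})) F\<^sub>c \<and>
        (\<forall>x\<in>chart_image c. \<forall>y. y \<noteq> 0 \<longrightarrow> (\<forall>w. w \<noteq> 0 \<longrightarrow>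
           (\<Sum>i\<in>UNIV. \<Sum>j\<in>UNIV.
              1/2 * partial i (partial j (\<lambda>y. (F\<^sub>c (x, y))\<^sup>2)) y * w $ i * w $ j) > 0)))"

definition strongly_convex_wrt ::
  "('a, real^'n) chart set \<Rightarrow> ('a \<times> ('a, real^'n) tvec \<Rightarrow> real) \<Rightarrow>
     ('a \<times> ('a, real^'n) tvec \<Rightarrow> real) \<Rightarrow> bool" where
  "strongly_convex_wrt A F F' \<longleftrightarrow>
     (\<forall>p. \<forall>y\<in>tangent_space A p. \<forall>z\<in>tangent_space A p.
        \<forall>\<alpha>\<in>subdifferential (tangent_space A p) (\<lambda>v. (F (p, v))\<^sup>2) y.
          (F (p, z))\<^sup>2 \<ge> (F (p, y))\<^sup>2 + \<alpha> (z - y) + (F' (p, z - y))\<^sup>2)"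

definition unit_sphere ::
  "('a, real^'n) chart set \<Rightarrow> ('a \<times> ('a, real^'n) tvec \<Rightarrow> real) \<Rightarrow> 'a \<Rightarrow>
     ('a, real^'n) tvec set" where
  "unit_sphere A F p = {y \<in> tangent_space A p. F (p, y) = 1}"


subsection \<open>Horizontally smooth families of asymmetric norms\<close>

definition hpartial ::
  "'n::finite \<Rightarrow> ((real^'n) \<times> (real^'n) \<Rightarrow> real) \<Rightarrow> (real^'n) \<times> (real^'n) \<Rightarrow> real" where
  "hpartial i G z = partial i (\<lambda>x. G (x, snd z)) (fst z)"

definition horizontally_C1 ::
  "(real^'n) set \<Rightarrow> ((real^'n) \<times> (real^'n) \<Rightarrow> real) \<Rightarrow> bool" where
  "horizontally_C1 W G \<longleftrightarrow>
     continuous_on (W \<times> UNIV) G \<and> (\<forall>x\<in>W. asymmetric_norm UNIV (\<lambda>y. G (x, y))) \<and>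
     (\<forall>i. (\<forall>x\<in>W. \<forall>y. has_partial i (\<lambda>x. G (x, y)) x) \<and>
          continuous_on (W \<times> UNIV) (hpartial i G))"

definition horizontally_C2 ::
  "(real^'n) set \<Rightarrow> ((real^'n) \<times> (real^'n) \<Rightarrow> real) \<Rightarrow> bool" where
  "horizontally_C2 W G \<longleftrightarrow> horizontally_C1 W G \<and>
     (\<forall>i j. (\<forall>x\<in>W. \<forall>y. y \<noteq> 0 \<longrightarrow> has_partial i (\<lambda>x. hpartial j G (x, y)) x) \<and>
            continuous_on (W \<times> (UNIV - {0})) (hpartial i (hpartial j G)))"

definition horizontal_differential ::
  "((real^'n) \<times> (real^'n) \<Rightarrow> real) \<Rightarrow> (real^'n) \<times> (real^'n) \<Rightarrow> real^'n" where
  "horizontal_differential G z = (\<chi> i. hpartial i G z)"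


subsection \<open>Pontryagin type and the extended geodesic field\<close>

text \<open>\<open>f x u\<close> are the components of the vector field \<open>X\<^sub>u\<close> at the point with coordinates \<open>x\<close>.\<close>

definition pontryagin_family ::
  "('a, real^'n) chart set \<Rightarrow> ('a \<times> ('a, real^'n) tvec \<Rightarrow> real) \<Rightarrow> ('a, real^'n) chart \<Rightarrow>
     (real^'n \<Rightarrow> real^'n \<Rightarrow> real^'n) \<Rightarrow> bool" where
  "pontryagin_family A F c f \<longleftrightarrow>
     (\<forall>u\<in>sphere 0 1. Ck_on 1 (chart_image c) (\<lambda>x. f x u)) \<and>
     (\<forall>p\<in>fst c. \<exists>g. homeomorphism (sphere 0 1) ((\<lambda>y. y c) ` unit_sphere A F p) (f (snd c p)) g) \<and>
     continuous_on (chart_image c \<times> sphere 0 1) (\<lambda>(x, u). f x u) \<and>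
     (\<forall>i. continuous_on (chart_image c \<times> sphere 0 1)
            (\<lambda>(x, u). \<chi> j. partial i (\<lambda>x. f x u $ j) x))"

definition hamiltonian ::
  "('a, real^'n) chart set \<Rightarrow> ('a, real^'n) chart \<Rightarrow> (real^'n \<Rightarrow> real^'n \<Rightarrow> real^'n) \<Rightarrow> real^'n \<Rightarrow>
     'a \<times> ('a, real^'n) covec \<Rightarrow> real" where
  "hamiltonian A c f u = (\<lambda>(p, \<alpha>). \<alpha> (coord_vector A c p (f (snd c p) u)))"

definition hamiltonian_vector ::
  "('a, real^'n) chart set \<Rightarrow> ('a, real^'n) chart \<Rightarrow> (real^'n \<Rightarrow> real^'n \<Rightarrow> real^'n) \<Rightarrow> real^'n \<Rightarrow>
     'a \<times> ('a, real^'n) covec \<Rightarrow>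
     ('a \<times> ('a, real^'n) covec, (real^'n) \<times> (real^'n)) tvec" where
  "hamiltonian_vector A c f u = (\<lambda>(p, \<alpha>).
     coord_vector (cotangent_atlas A) (cotangent_chart A c) (p, \<alpha>)
       (f (snd c p) u,
        \<chi> i. - (\<Sum>j\<in>UNIV. covec_coords A c p \<alpha> $ j * partial i (\<lambda>x. f x u $ j) (snd c p))))"

text \<open>The extended geodesic field of \<open>(U, F)\<close>. The value obtained from one Pontryagin family around
  \<open>p\<close> does not depend on the family or its coordinates, so the vectors given by all of them are
  collected; the value is empty where there is no such family.\<close>

definition extended_geodesic_field ::
  "('a, real^'n) chart set \<Rightarrow> 'a set \<Rightarrow> ('a \<times> ('a, real^'n) tvec \<Rightarrow> real) \<Rightarrow>
     'a \<times> ('a, real^'n) covec \<Rightarrow>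
     ('a \<times> ('a, real^'n) covec, (real^'n) \<times> (real^'n)) tvec set" where
  "extended_geodesic_field A U F z =
     {hamiltonian_vector A c f u z | c f u.
        c \<in> A \<and> fst c \<subseteq> U \<and> fst z \<in> fst c \<and> pontryagin_family A F c f \<and> u \<in> sphere 0 1 \<and>
        (\<forall>v\<in>sphere 0 1. hamiltonian A c f v z \<le> hamiltonian A c f u z)}"

definition locally_lipschitz_vector_field ::
  "('a, real^'n) chart set \<Rightarrow> 'a set \<Rightarrow>
     ('a \<times> ('a, real^'n) covec \<Rightarrow>
       ('a \<times> ('a, real^'n) covec, (real^'n) \<times> (real^'n)) tvec set) \<Rightarrow> bool" where
  "locally_lipschitz_vector_field A U E \<longleftrightarrow>
     (\<forall>z\<in>slit_cotangent_bundle A U. \<exists>\<xi>\<in>tangent_space (cotangent_atlas A) z. E z = {\<xi>}) \<and>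
     (\<forall>c\<in>A. fst c \<subseteq> U \<longrightarrow>
        locally_lipschitz_on (chart_image c \<times> (UNIV - {0}))
          (\<lambda>w. the_elem (E (chart_inv (cotangent_chart A c) w)) (cotangent_chart A c)))"

end

theory Submission
  imports Defs
begin

text \<open>
  Let \<open>H\<close> be the norm dual to \<open>F\<close>, a function on the cotangent bundle. If \<open>X\<^sub>u\<close> is a Pontryagin
  family and \<open>u\<close> is a maximizer at \<open>z\<close>, then \<open>H\<^sub>u \<le> H\<close> with equality at \<open>z\<close>; so, once \<open>H\<close> is known to be
  differentiable, \<open>H\<^sub>u\<close> and \<open>H\<close> have the same differential at \<open>z\<close>, and the extended geodesic field is
  the Hamiltonian vector field of \<open>H\<close>, whatever the family and the coordinates.

  In the trivialization, \<open>F\<close> becomes a family \<open>G (x, \<sqdot>)\<close> of norms on \<open>real^'n\<close>, and \<open>H\<^sup>2\<close> at \<open>(x, \<beta>)\<close> is the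
  maximum of \<open>2 (\<beta> \<bullet> y) - G\<^sup>2 (x, y)\<close>, attained at some \<open>\<xi> (x, \<beta>)\<close>. Adding the two strong convexity
  inequalities at \<open>\<xi> (x, \<beta>)\<close> and \<open>\<xi> (x', \<beta>')\<close> and estimating \<open>G\<^sup>2\<close> at \<open>x\<close> and \<open>x'\<close> with the Lipschitz
  horizontal differential shows that \<open>\<xi>\<close> is locally Lipschitz. By the envelope theorem \<open>H\<^sup>2\<close> is
  differentiable with differential \<open>2 \<xi> \<bullet> d\<beta> - d\<^sub>hG\<^sup>2 (x, \<xi>)\<close>, which is then locally Lipschitz as well.
\<close>

subsection \<open>Calculus\<close>

text \<open>\<open>G\<close> is merely convex along the fibres, so the Legendre transform cannot be
  inverted by the implicit function theorem; subgradients and the gap \<open>K\<close>, which on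
  compact sets dominates a multiple of the Euclidean norm, replace it. In the sum of the two strong
  convexity inequalities at maximizers \<open>y1\<close> and \<open>y2\<close>, the gap is of the
  order of the square of \<open>norm (y2 - y1)\<close>; the Lipschitz condition on the horizontal
  differential supplies one factor \<open>norm (y2 - y1)\<close> on the other side, which cancels. A
  mere bound on that differential would leave this argument with Hoelder exponent 1/2. The
  trivialization need not come from the coordinates: a covector enters through the transpose of a
  moving frame \<open>B\<close>, whose derivative adds a term to the differential of the dual norm.
  Charts are compared through the canonical symplectic form, which the transitions of the cotangent
  bundle preserve by the symmetry of second derivatives. Finally, the field is by definition empty
  where no Pontryagin family exists, so one has to be exhibited.\<close>

lemma double_mvt:
  fixes f :: "'e::real_normed_vector \<Rightarrow> real"
  assumes t: "0 < t"
    and S: "\<And>r s. r \<in> {0..t} \<Longrightarrow> s \<in> {0..t} \<Longrightarrow> x + r *\<^sub>R u + s *\<^sub>R v \<in> S"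
    and f: "\<And>y. y \<in> S \<Longrightarrow> (f has_derivative D y) (at y)"
    and Du: "\<And>y. y \<in> S \<Longrightarrow> ((\<lambda>y. D y u) has_derivative D2 y) (at y)"
  shows "\<exists>r\<in>{0..t}. \<exists>s\<in>{0..t}.
    f (x + t *\<^sub>R u + t *\<^sub>R v) - f (x + t *\<^sub>R u) - f (x + t *\<^sub>R v) + f x = t * t * D2 (x + r *\<^sub>R u + s *\<^sub>R v) v"
proof -
  \<comment> \<open>The increment of \<open>f\<close> in direction \<open>v\<close>. Its own
    increment in direction \<open>u\<close> is the mixed second difference, so the mean value
    theorem applies first to \<open>g\<close> and then to the derivative along
    \<open>u\<close>.\<close>
  define g where "g = (\<lambda>r. f (x + r *\<^sub>R u + t *\<^sub>R v) - f (x + r *\<^sub>R u))"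
  have line: "((\<lambda>r. h (y + r *\<^sub>R w)) has_real_derivative H w) (at r)"
    if "(h has_derivative H) (at (y + r *\<^sub>R w))" for h :: "'e \<Rightarrow> real" and H y w r
  proof -
    have "((\<lambda>r. h (y + r *\<^sub>R w)) has_derivative (\<lambda>r. H (r *\<^sub>R w))) (at r)"
      by (rule has_derivative_compose[where g = h and f = "\<lambda>r. y + r *\<^sub>R w"])
        (use that in \<open>auto intro!: derivative_eq_intros\<close>)
    moreover have "(\<lambda>r. H (r *\<^sub>R w)) = (*) (H w)"
      using linear_cmul[OF has_derivative_linear[OF that]] by (auto simp: mult.commute)
    ultimately show ?thesis by (simp add: has_field_derivative_def)
  qed
  have "\<exists>r>0. r < t \<and> g t - g 0 = (t - 0) * (D (x + r *\<^sub>R u + t *\<^sub>R v) u - D (x + r *\<^sub>R u) u)"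
  proof (rule MVT2[OF t])
    fix r assume r: "0 \<le> r" "r \<le> t"
    have 1: "((\<lambda>r. f ((x + t *\<^sub>R v) + r *\<^sub>R u)) has_real_derivative D ((x + t *\<^sub>R v) + r *\<^sub>R u) u) (at r)"
      by (rule line, rule f) (use S[of r t] r t in \<open>auto simp: algebra_simps\<close>)
    have 2: "((\<lambda>r. f (x + r *\<^sub>R u)) has_real_derivative D (x + r *\<^sub>R u) u) (at r)"
      by (rule line, rule f) (use S[of r 0] r t in \<open>auto simp: algebra_simps\<close>)
    show "(g has_real_derivative D (x + r *\<^sub>R u + t *\<^sub>R v) u - D (x + r *\<^sub>R u) u) (at r)"
      unfolding g_def using DERIV_diff[OF 1 2] by (simp add: algebra_simps)
  qed
  then obtain r where r: "0 < r" "r < t"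
    "g t - g 0 = t * (D (x + r *\<^sub>R u + t *\<^sub>R v) u - D (x + r *\<^sub>R u) u)" by auto
  have "\<exists>s>0. s < t \<and> D (x + r *\<^sub>R u + t *\<^sub>R v) u - D (x + r *\<^sub>R u + 0 *\<^sub>R v) u
      = (t - 0) * D2 (x + r *\<^sub>R u + s *\<^sub>R v) v"
    by (rule MVT2[OF t], rule line, rule Du, rule S) (use r in auto)
  then obtain s where s: "0 < s" "s < t"
    "D (x + r *\<^sub>R u + t *\<^sub>R v) u - D (x + r *\<^sub>R u) u = t * D2 (x + r *\<^sub>R u + s *\<^sub>R v) v" by auto
  show ?thesis
    using r s by (intro bexI[of _ r] bexI[of _ s]) (auto simp: g_def)
qed

text \<open>The mixed second difference is symmetric in \<open>u\<close> and \<open>v\<close>. By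
  \<open>double_mvt\<close>, its quotient by \<open>t * t\<close> is a value of either mixed
  derivative near \<open>x\<close>, and continuity forces the two values at \<open>x\<close>
  together.\<close>

lemma mixed_derivatives_eq:
  fixes f :: "'e::real_normed_vector \<Rightarrow> real"
  assumes "open S" and x: "x \<in> S"
    and f: "\<And>y. y \<in> S \<Longrightarrow> (f has_derivative D y) (at y)"
    and Du: "\<And>y. y \<in> S \<Longrightarrow> ((\<lambda>y. D y u) has_derivative Du y) (at y)"
    and Dv: "\<And>y. y \<in> S \<Longrightarrow> ((\<lambda>y. D y v) has_derivative Dv y) (at y)"
    and cu: "continuous_on S (\<lambda>y. Du y v)" and cv: "continuous_on S (\<lambda>y. Dv y u)"
  shows "Du x v = Dv x u"
proof (rule ccontr)
  assume ne: "Du x v \<noteq> Dv x u"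
  \<comment> \<open>Half the gap: a number within \<open>e\<close> of \<open>Du x v\<close> cannot
    also be within \<open>e\<close> of \<open>Dv x u\<close>.\<close>
  define e where "e = \<bar>Du x v - Dv x u\<bar> / 2"
  have e: "e > 0" using ne by (simp add: e_def)
  obtain d0 where d0: "d0 > 0" "ball x d0 \<subseteq> S" using assms(1) x by (meson openE)
  obtain d1 where d1: "d1 > 0" "\<And>y. y \<in> S \<Longrightarrow> dist y x < d1 \<Longrightarrow> dist (Du y v) (Du x v) < e"
    using cu x e unfolding continuous_on_iff by metis
  obtain d2 where d2: "d2 > 0" "\<And>y. y \<in> S \<Longrightarrow> dist y x < d2 \<Longrightarrow> dist (Dv y u) (Dv x u) < e"
    using cv x e unfolding continuous_on_iff by metis
  define d where "d = min d0 (min d1 d2)"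
  have d: "d > 0" using d0 d1 d2 by (simp add: d_def)
  \<comment> \<open>Keeps the parallelogram with sides \<open>t *\<^sub>R u\<close> and
    \<open>t *\<^sub>R v\<close> in the ball of radius \<open>d\<close>; the summand 1 covers
    \<open>u = v = 0\<close> and makes the bound strict.\<close>
  define t where "t = d / (norm u + norm v + 1)"
  have t: "t > 0" using d by (simp add: t_def add_nonneg_pos)
  have near: "dist (x + r *\<^sub>R u + s *\<^sub>R v) x < d" if "r \<in> {0..t}" "s \<in> {0..t}" for r s
  proof -
    have "dist (x + r *\<^sub>R u + s *\<^sub>R v) x = norm (r *\<^sub>R u + s *\<^sub>R v)" by (simp add: dist_norm add.assoc)
    also have "\<dots> \<le> r * norm u + s * norm v"
      using that by (auto intro: order_trans[OF norm_triangle_ineq])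
    also have "\<dots> \<le> t * norm u + t * norm v"
      using that by (intro add_mono mult_right_mono) auto
    also have "\<dots> < t * (norm u + norm v + 1)" using t by (simp add: algebra_simps)
    also have "\<dots> = d" unfolding t_def by (simp add: add_nonneg_eq_0_iff add_nonneg_pos less_imp_neq[THEN not_sym])
    finally show ?thesis .
  qed
  have inS: "x + r *\<^sub>R u + s *\<^sub>R v \<in> S" if "r \<in> {0..t}" "s \<in> {0..t}" for r s
    using near[OF that] d0 by (auto simp: d_def dist_commute)
  obtain r s where 1: "r \<in> {0..t}" "s \<in> {0..t}"
    "f (x + t *\<^sub>R u + t *\<^sub>R v) - f (x + t *\<^sub>R u) - f (x + t *\<^sub>R v) + f x = t * t * Du (x + r *\<^sub>R u + s *\<^sub>R v) v"
    using double_mvt[OF t inS f Du] by blast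
  have inS': "x + r *\<^sub>R v + s *\<^sub>R u \<in> S" if "r \<in> {0..t}" "s \<in> {0..t}" for r s
    using inS[OF that(2,1)] by (simp add: algebra_simps)
  obtain r' s' where 2: "r' \<in> {0..t}" "s' \<in> {0..t}"
    "f (x + t *\<^sub>R v + t *\<^sub>R u) - f (x + t *\<^sub>R v) - f (x + t *\<^sub>R u) + f x = t * t * Dv (x + r' *\<^sub>R v + s' *\<^sub>R u) u"
    using double_mvt[OF t inS' f Dv] by blast
  have "t * t * Du (x + r *\<^sub>R u + s *\<^sub>R v) v = t * t * Dv (x + r' *\<^sub>R v + s' *\<^sub>R u) u"
    using 1(3) 2(3) by (simp add: algebra_simps)
  then have eq: "Du (x + r *\<^sub>R u + s *\<^sub>R v) v = Dv (x + s' *\<^sub>R u + r' *\<^sub>R v) u"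
    using t by (simp add: algebra_simps)
  have "\<bar>Du (x + r *\<^sub>R u + s *\<^sub>R v) v - Du x v\<bar> < e"
    using d1(2)[OF inS[OF 1(1,2)]] near[OF 1(1,2)] by (simp add: d_def dist_real_def)
  moreover have "\<bar>Dv (x + s' *\<^sub>R u + r' *\<^sub>R v) u - Dv x u\<bar> < e"
    using d2(2)[OF inS[OF 2(2,1)]] near[OF 2(2,1)] by (simp add: d_def dist_real_def)
  ultimately show False using eq by (simp add: e_def abs_if split: if_splits)
qed

lemma smooth_on_differentiable:
  "smooth_on S f \<Longrightarrow> x \<in> S \<Longrightarrow> (f has_derivative frechet_derivative f (at x)) (at x)"
  by (metis Ck_on.simps(2) frechet_derivative_works smooth_on_def)

lemma smooth_on_frechet_derivative:
  "smooth_on S f \<Longrightarrow> smooth_on S (\<lambda>x. frechet_derivative f (at x) v)"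
  unfolding smooth_on_def by (metis Ck_on.simps(2))

lemma smooth_on_continuous: "smooth_on S f \<Longrightarrow> continuous_on S f"
  unfolding smooth_on_def by (metis Ck_on.simps(1))

lemma second_derivative_symmetric:
  fixes f :: "'e::euclidean_space \<Rightarrow> 'f::euclidean_space"
  assumes S: "open S" "x \<in> S" and f: "smooth_on S f"
  shows "frechet_derivative (\<lambda>y. frechet_derivative f (at y) u) (at x) v =
    frechet_derivative (\<lambda>y. frechet_derivative f (at y) v) (at x) u"
proof (rule euclidean_eqI)
  fix b :: 'f
  let ?D = "\<lambda>w y. frechet_derivative f (at y) w"
  have 1: "((\<lambda>y. f y \<bullet> b) has_derivative (\<lambda>w. ?D w y \<bullet> b)) (at y)" if "y \<in> S" for y
    by (rule has_derivative_inner_left[OF smooth_on_differentiable[OF f that]])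
  have 2: "((\<lambda>y. ?D w y \<bullet> b) has_derivative (\<lambda>v. frechet_derivative (?D w) (at y) v \<bullet> b)) (at y)" if "y \<in> S" for y w
    by (rule has_derivative_inner_left[OF smooth_on_differentiable[OF smooth_on_frechet_derivative[OF f] that]])
  show "frechet_derivative (?D u) (at x) v \<bullet> b = frechet_derivative (?D v) (at x) u \<bullet> b"
    by (rule mixed_derivatives_eq[OF S 1 2 2])
      (intro continuous_on_inner continuous_on_const smooth_on_continuous smooth_on_frechet_derivative f | assumption)+
qed

section \<open>Partial derivatives and total differentiability\<close>

lemma has_partial_DERIV:
  assumes "has_partial i f (y + t *\<^sub>R axis i 1)"
  shows "((\<lambda>t. f (y + t *\<^sub>R axis i 1)) has_real_derivative partial i f (y + t *\<^sub>R axis i 1)) (at t)"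
proof -
  have "((\<lambda>s. f (y + t *\<^sub>R axis i 1 + s *\<^sub>R axis i 1)) has_real_derivative partial i f (y + t *\<^sub>R axis i 1)) (at 0)"
    using assms unfolding has_partial_def partial_def
    by (meson DERIV_deriv_iff_has_field_derivative DERIV_deriv_iff_real_differentiable real_differentiable_def differentiableI)
  then have "((\<lambda>s. f (y + (t + s) *\<^sub>R axis i 1)) has_real_derivative partial i f (y + t *\<^sub>R axis i 1)) (at 0)"
    by (simp add: algebra_simps)
  then show ?thesis
    using DERIV_at_within_shift[of "\<lambda>t. f (y + t *\<^sub>R axis i 1)" _ t 0 UNIV] by (simp add: add.commute)
qed

lemma has_derivative_imp_partial:
  assumes "(f has_derivative D) (at x)"
  shows "partial i f x = D (axis i 1)"
proof -
  have "((\<lambda>t. f (x + t *\<^sub>R axis i 1)) has_derivative (\<lambda>t. D (t *\<^sub>R axis i 1))) (at 0)"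
    by (rule has_derivative_compose[where g = f]) (use assms in \<open>auto intro!: derivative_eq_intros\<close>)
  moreover have "(\<lambda>t. D (t *\<^sub>R axis i 1)) = (*) (D (axis i 1))"
    using linear_cmul[OF has_derivative_linear[OF assms]] by (auto simp: mult.commute)
  ultimately have "((\<lambda>t. f (x + t *\<^sub>R axis i 1)) has_real_derivative D (axis i 1)) (at 0)"
    by (simp add: has_field_derivative_def)
  then show ?thesis
    unfolding partial_def by (rule DERIV_imp_deriv)
qed

text \<open>The increment is split into moves along one axis at a time; each is controlled by the
  mean value theorem and the continuity of the corresponding partial derivative.\<close>

lemma has_derivative_partials:
  fixes f :: "real^'n \<Rightarrow> real"
  assumes W: "open W" "x \<in> W"
    and p: "\<And>i y. y \<in> W \<Longrightarrow> has_partial i f y"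
    and c: "\<And>i. continuous_on W (partial i f)"
  shows "(f has_derivative (\<lambda>h. \<Sum>i\<in>UNIV. h $ i * partial i f x)) (at x)"
  unfolding has_derivative_at_alt
proof (intro conjI allI impI)
  show "bounded_linear (\<lambda>h. \<Sum>i\<in>UNIV. h $ i * partial i f x)"
    by (intro bounded_linear_sum bounded_linear_mult_const bounded_linear_vec_nth)
  fix e :: real assume e: "e > 0"
  \<comment> \<open>The moves cost \<open>e'\<close> times the sum of the
    \<open>\<bar>h $ i\<bar>\<close>, and that sum is at most \<open>CARD('n)\<close> times
    \<open>norm h\<close>.\<close>
  define e' where "e' = e / (real CARD('n))"
  have e': "e' > 0" using e by (simp add: e'_def)
  have "\<forall>i. \<exists>d>0. \<forall>y\<in>W. dist y x < d \<longrightarrow> \<bar>partial i f y - partial i f x\<bar> < e'"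
    using c W(2) e' unfolding continuous_on_iff dist_real_def by metis
  then obtain d' where d': "\<And>i. d' i > 0" "\<And>i y. y \<in> W \<Longrightarrow> dist y x < d' i \<Longrightarrow> \<bar>partial i f y - partial i f x\<bar> < e'"
    by metis
  obtain d0 where d0: "d0 > 0" "ball x d0 \<subseteq> W" using W by (meson openE)
  define d where "d = min d0 (Min (range d'))"
  have d: "d > 0" using d' d0 by (auto simp: d_def)
  have dd: "d \<le> d' i" "d \<le> d0" for i by (auto simp: d_def intro: min.coboundedI2)
  have main: "\<bar>f (x + h) - f x - (\<Sum>i\<in>UNIV. h $ i * partial i f x)\<bar> \<le> e * norm h" if h: "norm h < d" for h
  proof -
    have norm_le: "norm k < d" if "\<And>i. \<bar>k $ i\<bar> \<le> \<bar>h $ i\<bar>" for k :: "real^'n"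
      using norm_le_componentwise_cart[of k h] that h by auto
    \<comment> \<open>Induction over the set \<open>I\<close> of coordinates already moved; the
      others still have their values at \<open>x\<close>.\<close>
    have "\<bar>f (x + (\<chi> i. if i \<in> I then h $ i else 0)) - f x - (\<Sum>i\<in>I. h $ i * partial i f x)\<bar>
        \<le> e' * (\<Sum>i\<in>I. \<bar>h $ i\<bar>)" if "finite I" for I
      using that
    proof (induction I)
      case empty
      have "x + (\<chi> i. 0) = x" by (simp add: vec_eq_iff)
      then show ?case by simp
    next
      case (insert j I)
      define y where "y = x + (\<chi> i. if i \<in> I then h $ i else 0)"
      \<comment> \<open>Subtracting the linear term turns the derivative of \<open>q\<close> into a
        difference of two values of \<open>partial j f\<close>, which is below \<open>e'\<close> in
        absolute value.\<close>
      define q where "q = (\<lambda>t. f (y + t *\<^sub>R axis j 1) - t * partial j f x)"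
      have y: "y + t *\<^sub>R axis j 1 \<in> W" "dist (y + t *\<^sub>R axis j 1) x < d" if "\<bar>t\<bar> \<le> \<bar>h $ j\<bar>" for t
      proof -
        have "norm ((\<chi> i. if i \<in> I then h $ i else 0) + t *\<^sub>R axis j 1) < d"
          by (rule norm_le) (use that insert(2) in \<open>auto simp: axis_def\<close>)
        then show "dist (y + t *\<^sub>R axis j 1) x < d" by (simp add: dist_norm y_def add.assoc)
        then show "y + t *\<^sub>R axis j 1 \<in> W" using d0 dd(2) by (force simp: dist_commute)
      qed
      have "norm (q (h $ j) - q 0) \<le> e' * norm (h $ j - 0)"
      proof (rule field_differentiable_bound[where S = "closed_segment 0 (h $ j)"])
        fix t assume "t \<in> closed_segment 0 (h $ j)"
        then have t: "\<bar>t\<bar> \<le> \<bar>h $ j\<bar>" by (auto simp: closed_segment_eq_real_ivl split: if_splits)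
        have "(q has_real_derivative (partial j f (y + t *\<^sub>R axis j 1) - partial j f x)) (at t)"
          unfolding q_def by (auto intro!: derivative_eq_intros has_partial_DERIV p y t)
        then show "(q has_real_derivative (partial j f (y + t *\<^sub>R axis j 1) - partial j f x)) (at t within closed_segment 0 (h $ j))"
          by (rule has_field_derivative_at_within)
        show "norm (partial j f (y + t *\<^sub>R axis j 1) - partial j f x) \<le> e'"
          using d'(2)[OF y(1)[OF t], of j] y(2)[OF t] dd(1)[of j] by simp
      qed auto
      then have 1: "\<bar>f (y + (h $ j) *\<^sub>R axis j 1) - f y - h $ j * partial j f x\<bar> \<le> e' * \<bar>h $ j\<bar>"
        by (simp add: q_def algebra_simps)
      have "y + (h $ j) *\<^sub>R axis j 1 = x + (\<chi> i. if i \<in> insert j I then h $ i else 0)"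
        using insert(2) by (auto simp: vec_eq_iff y_def axis_def)
      then have "f (x + (\<chi> i. if i \<in> insert j I then h $ i else 0)) - f x - (\<Sum>i\<in>insert j I. h $ i * partial i f x)
        = (f (y + (h $ j) *\<^sub>R axis j 1) - f y - h $ j * partial j f x)
          + (f y - f x - (\<Sum>i\<in>I. h $ i * partial i f x))"
        using insert(1,2) by simp
      also have "\<bar>\<dots>\<bar> \<le> e' * \<bar>h $ j\<bar> + e' * (\<Sum>i\<in>I. \<bar>h $ i\<bar>)"
        using insert(3) 1 by (intro order_trans[OF abs_triangle_ineq] add_mono) (simp_all add: y_def)
      also have "\<dots> = e' * (\<Sum>i\<in>insert j I. \<bar>h $ i\<bar>)"
        using insert(1,2) by (simp add: distrib_left)
      finally show ?case .
    qed
    from this[OF finite_class.finite_UNIV]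
    have "\<bar>f (x + h) - f x - (\<Sum>i\<in>UNIV. h $ i * partial i f x)\<bar> \<le> e' * (\<Sum>i\<in>UNIV. \<bar>h $ i\<bar>)" by simp
    also have "(\<Sum>i\<in>UNIV. \<bar>h $ i\<bar>) \<le> (\<Sum>i\<in>(UNIV::'n set). norm h)" by (intro sum_mono component_le_norm_cart)
    then have "e' * (\<Sum>i\<in>UNIV. \<bar>h $ i\<bar>) \<le> e * norm h"
      using mult_left_mono[of _ _ e'] e' by (fastforce simp: e'_def)
    finally show ?thesis .
  qed
  show "\<exists>d>0. \<forall>y. norm (y - x) < d \<longrightarrow>
      norm (f y - f x - (\<Sum>i\<in>UNIV. (y - x) $ i * partial i f x)) \<le> e * norm (y - x)"
    using main[of "_ - x"] d by (intro exI[of _ d]) auto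
qed

subsection \<open>Locally Lipschitz maps\<close>

lemma locally_lipschitz_on_cong:
  "(\<And>x. x \<in> S \<Longrightarrow> f x = g x) \<Longrightarrow> locally_lipschitz_on S f \<longleftrightarrow> locally_lipschitz_on S g"
  unfolding locally_lipschitz_on_def by (simp add: lipschitz_on_def)

lemma locally_lipschitz_on_imp_continuous_on:
  assumes "locally_lipschitz_on S f"
  shows "continuous_on S f"
  unfolding continuous_on_eq_continuous_within
proof
  fix x assume x: "x \<in> S"
  then obtain r L where r: "r > 0" "L-lipschitz_on (ball x r \<inter> S) f"
    using assms unfolding locally_lipschitz_on_def by blast
  then have "continuous_on (ball x r \<inter> S) f" by (simp add: lipschitz_on_continuous_on)
  then have "continuous (at x within (ball x r \<inter> S)) f"
    using x r by (simp add: continuous_on_eq_continuous_within)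
  moreover have "at x within (ball x r \<inter> S) = at x within S"
    using r by (intro at_within_nhd[of x "ball x r"]) auto
  ultimately show "continuous (at x within S) f" by simp
qed

lemma locally_lipschitz_on_compose:
  assumes f: "locally_lipschitz_on S f" and g: "locally_lipschitz_on T g" and "f ` S \<subseteq> T"
  shows "locally_lipschitz_on S (\<lambda>x. g (f x))"
  unfolding locally_lipschitz_on_def
proof
  fix x assume x: "x \<in> S"
  obtain r L where r: "r > 0" "L-lipschitz_on (ball x r \<inter> S) f"
    using f x unfolding locally_lipschitz_on_def by blast
  obtain s M where s: "s > 0" "M-lipschitz_on (ball (f x) s \<inter> T) g"
    using g x assms(3) unfolding locally_lipschitz_on_def by blast
  obtain d where d: "d > 0" "\<And>y. y \<in> S \<Longrightarrow> dist y x < d \<Longrightarrow> dist (f y) (f x) < s"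
    using locally_lipschitz_on_imp_continuous_on[OF f] x s(1) unfolding continuous_on_iff by metis
  have "(M * L)-lipschitz_on (ball x (min r d) \<inter> S) (\<lambda>x. g (f x))"
  proof (rule lipschitz_on_compose2[where f = f and g = g])
    show "L-lipschitz_on (ball x (min r d) \<inter> S) f" by (rule lipschitz_on_subset[OF r(2)]) auto
    show "M-lipschitz_on (f ` (ball x (min r d) \<inter> S)) g"
      by (rule lipschitz_on_subset[OF s(2)]) (use d assms(3) in \<open>auto simp: dist_commute\<close>)
  qed
  then show "\<exists>r>0. \<exists>L. L-lipschitz_on (ball x r \<inter> S) (\<lambda>x. g (f x))"
    using r d by (intro exI[of _ "min r d"]) auto
qed

lemma locally_lipschitz_on_Pair:
  assumes f: "locally_lipschitz_on S f" and g: "locally_lipschitz_on S g"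
  shows "locally_lipschitz_on S (\<lambda>x. (f x, g x))"
  unfolding locally_lipschitz_on_def
proof
  fix x assume x: "x \<in> S"
  obtain r L where r: "r > 0" "L-lipschitz_on (ball x r \<inter> S) f"
    using f x unfolding locally_lipschitz_on_def by blast
  obtain s M where s: "s > 0" "M-lipschitz_on (ball x s \<inter> S) g"
    using g x unfolding locally_lipschitz_on_def by blast
  have "(sqrt (L\<^sup>2 + M\<^sup>2))-lipschitz_on (ball x (min r s) \<inter> S) (\<lambda>x. (f x, g x))"
    by (intro lipschitz_on_Pair lipschitz_on_subset[OF r(2)] lipschitz_on_subset[OF s(2)]) auto
  then show "\<exists>r>0. \<exists>L. L-lipschitz_on (ball x r \<inter> S) (\<lambda>x. (f x, g x))"
    using r s by (intro exI[of _ "min r s"]) auto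
qed

text \<open>On a compact ball the derivative is bounded by the sum of its bounds on the basis
  vectors; convexity of the ball turns this into a Lipschitz bound.\<close>

lemma locally_lipschitz_on_C1:
  fixes f :: "'e::euclidean_space \<Rightarrow> 'f::real_normed_vector"
  assumes S: "open S"
    and f: "\<And>x. x \<in> S \<Longrightarrow> (f has_derivative D x) (at x)"
    and D: "\<And>v. continuous_on S (\<lambda>x. D x v)"
  shows "locally_lipschitz_on S f"
  unfolding locally_lipschitz_on_def
proof
  fix x assume x: "x \<in> S"
  obtain r where r: "r > 0" "cball x r \<subseteq> S" using S x open_contains_cball by blast
  have "\<exists>C. \<forall>y\<in>cball x r. norm (D y b) \<le> C" for b
    using compact_imp_bounded[OF compact_continuous_image[OF continuous_on_subset[OF D r(2)] compact_cball], of b]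
    by (auto simp: bounded_iff)
  then obtain C where C: "\<And>b y. y \<in> cball x r \<Longrightarrow> norm (D y b) \<le> C b" by metis
  define L where "L = (\<Sum>b\<in>Basis. C b)"
  have C0: "0 \<le> C b" for b using C[of x b] r by (auto intro: order_trans[OF norm_ge_zero])
  have on: "onorm (D y) \<le> L" if y: "y \<in> cball x r" for y
  proof (rule onorm_bound)
    show "0 \<le> L" unfolding L_def by (intro sum_nonneg C0)
    fix v
    have lin: "linear (D y)" using f y r(2) has_derivative_linear by blast
    have "D y v = D y (\<Sum>b\<in>Basis. (v \<bullet> b) *\<^sub>R b)" by (simp add: euclidean_representation)
    also have "\<dots> = (\<Sum>b\<in>Basis. (v \<bullet> b) *\<^sub>R D y b)" using lin by (simp add: linear_sum linear_cmul)
    also have "norm \<dots> \<le> (\<Sum>b\<in>Basis. norm v * C b)"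
      by (rule sum_norm_le) (auto intro!: mult_mono C y Basis_le_norm)
    also have "\<dots> = L * norm v" by (simp add: L_def sum_distrib_left mult.commute)
    finally show "norm (D y v) \<le> L * norm v" .
  qed
  have "L-lipschitz_on (ball x r \<inter> S) f"
  proof (rule lipschitz_onI)
    show "0 \<le> L" unfolding L_def by (intro sum_nonneg C0)
    fix y z assume "y \<in> ball x r \<inter> S" "z \<in> ball x r \<inter> S"
    then have yz: "y \<in> cball x r" "z \<in> cball x r" by auto
    show "dist (f y) (f z) \<le> L * dist y z"
      unfolding dist_norm
      by (rule differentiable_bound[OF convex_cball, where f' = D])
        (use f r(2) yz on in \<open>auto intro!: has_derivative_at_withinI[OF f]\<close>)
  qed
  then show "\<exists>r>0. \<exists>L. L-lipschitz_on (ball x r \<inter> S) f" using r by blast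
qed

lemma smooth_on_imp_locally_lipschitz_on:
  fixes f :: "'e::euclidean_space \<Rightarrow> 'f::euclidean_space"
  shows "open S \<Longrightarrow> smooth_on S f \<Longrightarrow> locally_lipschitz_on S f"
  by (rule locally_lipschitz_on_C1[where D = "\<lambda>x. frechet_derivative f (at x)"])
    (auto intro: smooth_on_differentiable smooth_on_continuous smooth_on_frechet_derivative)

lemma locally_lipschitz_on_bounded_linear:
  assumes "bounded_linear h" "locally_lipschitz_on S f"
  shows "locally_lipschitz_on S (\<lambda>x. h (f x))"
proof (rule locally_lipschitz_on_compose[OF assms(2), of UNIV])
  from bounded_linear.lipschitz_boundE[OF assms(1)] obtain B where "B-lipschitz_on UNIV h" by metis
  then show "locally_lipschitz_on UNIV h"
    unfolding locally_lipschitz_on_def by (metis Int_UNIV_right lipschitz_on_subset subset_UNIV zero_less_one)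
qed auto

text \<open>On a unit ball both factors are bounded by \<open>R\<close>, and changing one factor at
  a time costs \<open>R * K\<close> twice.\<close>

lemma (in bounded_bilinear) locally_lipschitz_on_prod:
  assumes "locally_lipschitz_on S f" "locally_lipschitz_on S g"
  shows "locally_lipschitz_on S (\<lambda>x. prod (f x) (g x))"
proof -
  have "locally_lipschitz_on UNIV (\<lambda>z. prod (fst z) (snd z))"
    unfolding locally_lipschitz_on_def
  proof
    fix z :: "'a \<times> 'b"
    obtain K where K: "K \<ge> 0" "\<And>a b. norm (prod a b) \<le> norm a * norm b * K"
      using nonneg_bounded by blast
    define R where "R = norm z + 1"
    have "(2 * R * K)-lipschitz_on (ball z 1 \<inter> UNIV) (\<lambda>z. prod (fst z) (snd z))"
    proof (rule lipschitz_onI)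
      show "0 \<le> 2 * R * K" using K by (simp add: R_def)
      fix u v assume "u \<in> ball z 1 \<inter> UNIV" "v \<in> ball z 1 \<inter> UNIV"
      then have "norm u \<le> R" "norm v \<le> R"
        unfolding R_def using norm_triangle_sub[of u z] norm_triangle_sub[of v z]
        by (auto simp: dist_norm norm_minus_commute)
      then have R: "norm (fst u) \<le> R" "norm (snd v) \<le> R"
        using norm_fst_le[of "fst u" "snd u"] norm_snd_le[of "snd v" "fst v"] by auto
      have d: "norm (fst u - fst v) \<le> norm (u - v)" "norm (snd u - snd v) \<le> norm (u - v)"
        using norm_fst_le[of "fst (u - v)" "snd (u - v)"] norm_snd_le[of "snd (u - v)" "fst (u - v)"]
        by (metis fst_diff prod.collapse, metis snd_diff prod.collapse)
      have "prod (fst u) (snd u) - prod (fst v) (snd v)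
          = prod (fst u) (snd u - snd v) + prod (fst u - fst v) (snd v)"
        by (simp add: diff_left diff_right)
      also have "norm \<dots> \<le> norm (fst u) * norm (snd u - snd v) * K + norm (fst u - fst v) * norm (snd v) * K"
        by (intro norm_triangle_le add_mono K)
      also have "\<dots> \<le> R * norm (u - v) * K + norm (u - v) * R * K"
        using K R d by (intro add_mono mult_mono) (auto simp: R_def)
      finally show "dist (prod (fst u) (snd u)) (prod (fst v) (snd v)) \<le> 2 * R * K * dist u v"
        by (simp add: dist_norm algebra_simps)
    qed
    then show "\<exists>r>0. \<exists>L. L-lipschitz_on (ball z r \<inter> UNIV) (\<lambda>z. prod (fst z) (snd z))"
      using zero_less_one by blast
  qed
  from locally_lipschitz_on_compose[OF locally_lipschitz_on_Pair[OF assms] this] show ?thesis by simp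
qed

lemmas locally_lipschitz_on_mult = bounded_bilinear.locally_lipschitz_on_prod[OF bounded_bilinear_mult]
  and locally_lipschitz_on_scaleR = bounded_bilinear.locally_lipschitz_on_prod[OF bounded_bilinear_scaleR]
  and locally_lipschitz_on_inner = bounded_bilinear.locally_lipschitz_on_prod[OF bounded_bilinear_inner]

lemma locally_lipschitz_on_ident: "locally_lipschitz_on S (\<lambda>x. x)"
  unfolding locally_lipschitz_on_def by (metis lipschitz_on_id zero_less_one)

lemma locally_lipschitz_on_const: "locally_lipschitz_on S (\<lambda>x. c)"
  unfolding locally_lipschitz_on_def by (metis lipschitz_on_constant zero_less_one)

lemma locally_lipschitz_on_add:
  fixes f g :: "_ \<Rightarrow> 'b::real_normed_vector"
  assumes "locally_lipschitz_on S f" "locally_lipschitz_on S g"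
  shows "locally_lipschitz_on S (\<lambda>x. f x + g x)"
  using locally_lipschitz_on_bounded_linear[OF _ locally_lipschitz_on_Pair[OF assms], of "\<lambda>z. fst z + snd z"]
  by (simp add: bounded_linear_add bounded_linear_fst bounded_linear_snd)

lemma locally_lipschitz_on_sum:
  fixes f :: "_ \<Rightarrow> _ \<Rightarrow> 'b::real_normed_vector"
  assumes "\<And>i. i \<in> I \<Longrightarrow> locally_lipschitz_on S (f i)"
  shows "locally_lipschitz_on S (\<lambda>x. \<Sum>i\<in>I. f i x)"
  using assms
  by (induction I rule: infinite_finite_induct) (auto intro: locally_lipschitz_on_const locally_lipschitz_on_add)

lemma locally_lipschitz_on_vec_lambda:
  fixes f :: "'n::finite \<Rightarrow> _ \<Rightarrow> real"
  assumes "\<And>i. locally_lipschitz_on S (f i)"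
  shows "locally_lipschitz_on S (\<lambda>x. \<chi> i. f i x)"
proof -
  have "(\<lambda>x. \<chi> i. f i x) = (\<lambda>x. \<Sum>i\<in>UNIV. f i x *\<^sub>R axis i 1)"
    by (simp add: fun_eq_iff vec_eq_iff axis_def if_distrib[of "(*) _"] cong: if_cong)
  moreover have "locally_lipschitz_on S (\<lambda>x. \<Sum>i\<in>UNIV. f i x *\<^sub>R axis i (1::real))"
    by (intro locally_lipschitz_on_sum locally_lipschitz_on_scaleR assms locally_lipschitz_on_const)
  ultimately show ?thesis by simp
qed

lemma locally_lipschitz_on_inverse_sqrt:
  assumes f: "locally_lipschitz_on S f" and pos: "\<And>x. x \<in> S \<Longrightarrow> f x > (0::real)"
  shows "locally_lipschitz_on S (\<lambda>x. inverse (sqrt (f x)))"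
proof (rule locally_lipschitz_on_compose[OF f])
  show "locally_lipschitz_on {0<..} (\<lambda>t::real. inverse (sqrt t))"
  proof (rule locally_lipschitz_on_C1)
    fix t :: real assume "t \<in> {0<..}"
    then show "((\<lambda>t. inverse (sqrt t)) has_derivative
      (\<lambda>h. - (inverse (sqrt t) * (h * (inverse (sqrt t) / 2)) * inverse (sqrt t)))) (at t)"
      by (auto intro!: derivative_eq_intros)
  qed (auto intro!: continuous_intros)
qed (use pos in auto)

subsection \<open>The Legendre transform of a strongly convex family of norms\<close>

text \<open>What remains after trivialization: \<open>G\<close> stands for \<open>F\<close> and
  \<open>K\<close> for the comparison structure, and functionals are inner products with a
  vector.\<close>

locale strongly_convex_family =
  fixes W :: "(real^'n) set" and G K :: "(real^'n) \<times> (real^'n) \<Rightarrow> real"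
  assumes open_W: "open W"
    and C1: "horizontally_C1 W G"
    and lipschitz: "locally_lipschitz_on (W \<times> UNIV) (horizontal_differential (\<lambda>z. (G z)\<^sup>2))"
    and K_cont: "continuous_on (W \<times> UNIV) K"
    and K_norm: "x \<in> W \<Longrightarrow> asymmetric_norm UNIV (\<lambda>y. K (x, y))"
    and strong: "x \<in> W \<Longrightarrow> (\<And>z. (G (x, z))\<^sup>2 \<ge> (G (x, y))\<^sup>2 + \<beta> \<bullet> (z - y)) \<Longrightarrow>
      (G (x, z))\<^sup>2 \<ge> (G (x, y))\<^sup>2 + \<beta> \<bullet> (z - y) + (K (x, z - y))\<^sup>2"
begin

abbreviation "g \<equiv> horizontal_differential (\<lambda>z. (G z)\<^sup>2)"

text \<open>The factor 2 makes \<open>\<beta>\<close> a subgradient of half the square of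
  \<open>G\<close>, whose convex conjugate is half the squared dual norm.\<close>

definition subgradient :: "real^'n \<Rightarrow> real^'n \<Rightarrow> real^'n \<Rightarrow> bool" where
  "subgradient x \<beta> y \<longleftrightarrow> (\<forall>z. (G (x, z))\<^sup>2 \<ge> (G (x, y))\<^sup>2 + 2 * (\<beta> \<bullet> (z - y)))"

text \<open>\<open>legendre x\<close> inverts the Legendre transform of \<open>G (x, \<sqdot>)\<^sup>2/2\<close>; \<open>dual_sq x\<close> is the square of the norm
  dual to \<open>G (x, \<sqdot>)\<close>.\<close>

definition legendre :: "real^'n \<Rightarrow> real^'n \<Rightarrow> real^'n" where
  "legendre x \<beta> = (SOME y. subgradient x \<beta> y)"

definition dual_sq :: "real^'n \<Rightarrow> real^'n \<Rightarrow> real" where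
  "dual_sq x \<beta> = \<beta> \<bullet> legendre x \<beta>"

lemma G_nonneg: "x \<in> W \<Longrightarrow> 0 \<le> G (x, y)"
  and G_eq_0: "x \<in> W \<Longrightarrow> G (x, y) = 0 \<longleftrightarrow> y = 0"
  and G_scale_pos: "x \<in> W \<Longrightarrow> r > 0 \<Longrightarrow> G (x, r *\<^sub>R y) = r * G (x, y)"
  using C1 by (auto simp: horizontally_C1_def asymmetric_norm_def)

lemma G_scale: "x \<in> W \<Longrightarrow> r \<ge> 0 \<Longrightarrow> G (x, r *\<^sub>R y) = r * G (x, y)"
  using G_scale_pos[of x r y] G_eq_0[of x 0] by (cases "r = 0") auto

lemma G_pos: "x \<in> W \<Longrightarrow> y \<noteq> 0 \<Longrightarrow> 0 < G (x, y)"
  using G_nonneg[of x y] G_eq_0[of x y] by linarith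

lemma G_cont: "continuous_on (W \<times> UNIV) G"
  using C1 by (simp add: horizontally_C1_def)

lemma G_cont_right: "x \<in> W \<Longrightarrow> continuous_on S (\<lambda>y. G (x, y))"
  by (rule continuous_on_compose2[OF G_cont]) (auto intro!: continuous_intros)

lemma has_derivative_G:
  assumes "x \<in> W"
  shows "((\<lambda>x. G (x, y)) has_derivative (\<lambda>h. \<Sum>i\<in>UNIV. h $ i * hpartial i G (x, y))) (at x)"
proof -
  have "((\<lambda>x. G (x, y)) has_derivative (\<lambda>h. \<Sum>i\<in>UNIV. h $ i * partial i (\<lambda>x. G (x, y)) x)) (at x)"
  proof (rule has_derivative_partials[OF open_W assms])
    show "has_partial i (\<lambda>x. G (x, y)) x'" if "x' \<in> W" for i x'
      using C1 that by (simp add: horizontally_C1_def)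
    fix i
    have "continuous_on (W \<times> UNIV) (hpartial i G)" using C1 by (simp add: horizontally_C1_def)
    then have "continuous_on W (\<lambda>x. hpartial i G (x, y))"
      by (rule continuous_on_compose2) (auto intro!: continuous_intros)
    then show "continuous_on W (partial i (\<lambda>x. G (x, y)))" by (simp add: hpartial_def)
  qed
  then show ?thesis by (simp add: hpartial_def)
qed

lemma has_derivative_G_sq:
  assumes "x \<in> W"
  shows "((\<lambda>x. (G (x, y))\<^sup>2) has_derivative (\<lambda>h. g (x, y) \<bullet> h)) (at x)"
proof -
  let ?D = "\<lambda>h. 2 * G (x, y) * (\<Sum>i\<in>UNIV. h $ i * hpartial i G (x, y))"
  have D: "((\<lambda>x. (G (x, y))\<^sup>2) has_derivative ?D) (at x)"
    by (rule derivative_eq_intros has_derivative_G assms refl)+ (simp add: fun_eq_iff)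
  have "g (x, y) \<bullet> h = ?D h" for h
  proof -
    have "g (x, y) \<bullet> h = (\<Sum>i\<in>UNIV. ?D (axis i 1) * h $ i)"
      by (simp add: horizontal_differential_def inner_vec_def hpartial_def has_derivative_imp_partial[OF D])
    also have "\<dots> = ?D h"
      by (simp add: axis_def if_distrib[of "\<lambda>a. a * _"] cong: if_cong) (simp add: sum_distrib_left mult_ac)
    finally show ?thesis .
  qed
  with D show ?thesis by simp
qed

text \<open>Here \<open>v\<close> maximizes \<open>\<beta>\<close> on the unit sphere of
  \<open>G (x, \<sqdot>)\<close>, with maximum \<open>h\<close>. Then
  \<open>2 * (\<beta> \<bullet> z)\<close> is at most \<open>2 * h * G (x, z)\<close>, hence at most
  the sum of the squares of \<open>h\<close> and \<open>G (x, z)\<close>, with equality at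
  \<open>z = h *\<^sub>R v\<close>.\<close>

lemma subgradientI:
  assumes x: "x \<in> W" and v: "G (x, v) = 1" "\<And>z. \<beta> \<bullet> z \<le> (\<beta> \<bullet> v) * G (x, z)" and h: "\<beta> \<bullet> v \<ge> 0"
  shows "subgradient x \<beta> ((\<beta> \<bullet> v) *\<^sub>R v)"
  unfolding subgradient_def
proof
  fix z
  let ?h = "\<beta> \<bullet> v"
  have "0 \<le> (G (x, z) - ?h)\<^sup>2" by simp
  then have "(G (x, z))\<^sup>2 \<ge> 2 * (?h * G (x, z)) - ?h * ?h"
    by (simp add: power2_eq_square algebra_simps)
  with v(2)[of z] show "(G (x, z))\<^sup>2 \<ge> (G (x, ?h *\<^sub>R v))\<^sup>2 + 2 * (\<beta> \<bullet> (z - ?h *\<^sub>R v))"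
    using x h v(1) by (simp add: G_scale power2_eq_square inner_diff_right)
qed

text \<open>Homogeneity reduces the supremum of \<open>\<beta> \<bullet> z / G (x, z)\<close> to the
  compact Euclidean sphere. The second conjunct is Euler's relation: both sides are the squared dual
  norm of \<open>\<beta>\<close>.\<close>

lemma subgradient_exists:
  assumes x: "x \<in> W"
  shows "\<exists>y. subgradient x \<beta> y \<and> \<beta> \<bullet> y = (G (x, y))\<^sup>2"
proof (cases "\<beta> = 0")
  case True
  then show ?thesis using G_eq_0[OF x, of 0] by (intro exI[of _ 0]) (simp add: subgradient_def)
next
  case False
  let ?q = "\<lambda>u. \<beta> \<bullet> u / G (x, u)"
  have "\<exists>u\<in>sphere 0 1. \<forall>w\<in>sphere 0 1. ?q w \<le> ?q u"
  proof (rule continuous_attains_sup)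
    show "sphere (0::real^'n) 1 \<noteq> {}" by simp
    have "w \<noteq> 0" if "w \<in> sphere 0 1" for w :: "real^'n" using that by auto
    then show "continuous_on (sphere 0 1) ?q"
      using G_eq_0[OF x] by (intro continuous_intros G_cont_right x) auto
  qed simp
  then obtain u where u: "u \<in> sphere 0 1" "\<And>w. w \<in> sphere 0 1 \<Longrightarrow> ?q w \<le> ?q u" by blast
  have Gu: "G (x, u) > 0" using u(1) by (intro G_pos x) auto
  define v where "v = (1 / G (x, u)) *\<^sub>R u"
  have v: "G (x, v) = 1" "\<beta> \<bullet> v = ?q u" using Gu x by (simp_all add: v_def G_scale)
  have le: "\<beta> \<bullet> z \<le> (\<beta> \<bullet> v) * G (x, z)" for z
  proof (cases "z = 0")
    case True
    then show ?thesis using G_eq_0[OF x, of 0] by simp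
  next
    case z: False
    have "?q ((1 / norm z) *\<^sub>R z) \<le> ?q u" by (rule u) (use z in simp)
    moreover have "G (x, (1 / norm z) *\<^sub>R z) = (1 / norm z) * G (x, z)" by (rule G_scale[OF x]) simp
    ultimately have "\<beta> \<bullet> z / G (x, z) \<le> \<beta> \<bullet> v" using z by (simp add: v)
    then show ?thesis using G_pos[OF x z] by (simp add: divide_le_eq)
  qed
  \<comment> \<open>Testing with \<open>z = \<beta>\<close> shows that the maximum is positive;
    \<open>subgradientI\<close> requires it to be nonnegative.\<close>
  have "0 < \<beta> \<bullet> \<beta>" using False by simp
  also note le[of \<beta>]
  finally have h: "\<beta> \<bullet> v > 0" using G_pos[OF x False] by (simp add: zero_less_mult_iff)
  show ?thesis
  proof (intro exI conjI)
    show "subgradient x \<beta> ((\<beta> \<bullet> v) *\<^sub>R v)" using subgradientI[OF x v(1) le] h by simp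
    show "\<beta> \<bullet> ((\<beta> \<bullet> v) *\<^sub>R v) = (G (x, (\<beta> \<bullet> v) *\<^sub>R v))\<^sup>2"
      using x h v(1) by (simp add: G_scale power2_eq_square)
  qed
qed

lemma subgradient_strong:
  assumes "x \<in> W" "subgradient x \<beta> y"
  shows "(G (x, z))\<^sup>2 \<ge> (G (x, y))\<^sup>2 + 2 * (\<beta> \<bullet> (z - y)) + (K (x, z - y))\<^sup>2"
  using strong[OF assms(1), of y "2 *\<^sub>R \<beta>" z] assms(2) unfolding subgradient_def by simp

text \<open>Adding the strong convexity inequalities at \<open>y\<close> and at \<open>z\<close>
  cancels everything but the two squares of \<open>K\<close>.\<close>

lemma subgradient_unique:
  assumes x: "x \<in> W" and "subgradient x \<beta> y" "subgradient x \<beta> z"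
  shows "y = z"
proof -
  have "\<beta> \<bullet> (z - y) + \<beta> \<bullet> (y - z) = 0" by (simp add: inner_diff_right)
  then have "(K (x, z - y))\<^sup>2 + (K (x, y - z))\<^sup>2 \<le> 0"
    using subgradient_strong[OF x assms(2), of z] subgradient_strong[OF x assms(3), of y] by linarith
  then have "K (x, z - y) = 0"
    by (smt (verit) zero_le_power2 zero_eq_power2)
  then show ?thesis using K_norm[OF x] by (simp add: asymmetric_norm_def)
qed

lemma subgradient_legendre:
  assumes "x \<in> W"
  shows "subgradient x \<beta> (legendre x \<beta>)" "dual_sq x \<beta> = (G (x, legendre x \<beta>))\<^sup>2"
proof -
  obtain y where y: "subgradient x \<beta> y" "\<beta> \<bullet> y = (G (x, y))\<^sup>2" using subgradient_exists[OF assms] by blast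
  then have "subgradient x \<beta> (legendre x \<beta>)" unfolding legendre_def by (metis someI)
  moreover from this have "legendre x \<beta> = y" using y subgradient_unique[OF assms] by blast
  ultimately show "subgradient x \<beta> (legendre x \<beta>)" "dual_sq x \<beta> = (G (x, legendre x \<beta>))\<^sup>2"
    using y by (auto simp: dual_sq_def)
qed

text \<open>Fenchel's inequality. Together with \<open>dual_sq_eq\<close> it exhibits
  \<open>dual_sq x \<beta>\<close> as a maximum over \<open>y\<close>, attained at
  \<open>legendre x \<beta>\<close>.\<close>

lemma dual_sq_ge:
  assumes "x \<in> W"
  shows "dual_sq x \<beta> \<ge> 2 * (\<beta> \<bullet> y) - (G (x, y))\<^sup>2"
  using subgradient_legendre[OF assms, of \<beta>]
  by (auto simp: subgradient_def dual_sq_def inner_diff_right dest!: spec[of _ y])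

lemma dual_sq_eq:
  assumes "x \<in> W"
  shows "dual_sq x \<beta> = 2 * (\<beta> \<bullet> legendre x \<beta>) - (G (x, legendre x \<beta>))\<^sup>2"
  using subgradient_legendre(2)[OF assms, of \<beta>] by (simp add: dual_sq_def)

lemma dual_sq_pos:
  assumes x: "x \<in> W" and "\<beta> \<noteq> 0"
  shows "dual_sq x \<beta> > 0"
proof (rule ccontr)
  assume "\<not> ?thesis"
  then have "(G (x, legendre x \<beta>))\<^sup>2 = 0"
    using subgradient_legendre(2)[OF x, of \<beta>] by (metis linorder_not_less order_antisym zero_le_power2)
  then have l: "legendre x \<beta> = 0" using G_eq_0[OF x] by simp
  \<comment> \<open>On the ray through \<open>\<beta>\<close> the linear term beats the quadratic
    one for small \<open>t\<close>; this choice makes the quadratic term at most half of the linear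
    one.\<close>
  define t where "t = \<beta> \<bullet> \<beta> / (1 + (G (x, \<beta>))\<^sup>2)"
  have b: "\<beta> \<bullet> \<beta> > 0" using assms by simp
  have t: "t > 0" unfolding t_def by (intro divide_pos_pos b) (simp add: add_pos_nonneg)
  have "2 * (\<beta> \<bullet> t *\<^sub>R \<beta>) - (G (x, t *\<^sub>R \<beta>))\<^sup>2 \<le> 0"
    using dual_sq_ge[OF x, of \<beta> "t *\<^sub>R \<beta>"] l by (simp add: dual_sq_def)
  then have "t * (2 * (\<beta> \<bullet> \<beta>)) \<le> t * (t * (G (x, \<beta>))\<^sup>2)"
    using t x by (simp add: G_scale power2_eq_square algebra_simps)
  then have "2 * (\<beta> \<bullet> \<beta>) \<le> t * (G (x, \<beta>))\<^sup>2" using t by simp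
  also have "\<dots> \<le> t * (1 + (G (x, \<beta>))\<^sup>2)" using t by simp
  also have "\<dots> = \<beta> \<bullet> \<beta>" unfolding t_def by (simp add: add_pos_nonneg less_imp_neq[THEN not_sym])
  finally show False using b by simp
qed

text \<open>Take \<open>y = (\<beta> \<bullet> v) *\<^sub>R v\<close> in \<open>dual_sq_ge\<close>.
  Homogeneity holds for nonnegative factors only, hence the separate case.\<close>

lemma inner_le_dual:
  assumes x: "x \<in> W" and "G (x, v) = 1"
  shows "\<beta> \<bullet> v \<le> sqrt (dual_sq x \<beta>)"
proof (cases "\<beta> \<bullet> v \<le> 0")
  case True
  then show ?thesis using subgradient_legendre(2)[OF x, of \<beta>] by (metis dual_order.trans real_sqrt_ge_0_iff zero_le_power2)
next
  case False
  then have "(\<beta> \<bullet> v)\<^sup>2 \<le> dual_sq x \<beta>"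
    using dual_sq_ge[OF x, of \<beta> "(\<beta> \<bullet> v) *\<^sub>R v"] assms by (simp add: G_scale power2_eq_square)
  then show ?thesis by (rule real_le_rsqrt)
qed

lemma dual_attained:
  assumes x: "x \<in> W" and "\<beta> \<noteq> 0"
  shows "\<exists>v. G (x, v) = 1 \<and> \<beta> \<bullet> v = sqrt (dual_sq x \<beta>)"
proof (intro exI conjI)
  let ?s = "sqrt (dual_sq x \<beta>)"
  have s: "?s > 0" using dual_sq_pos[OF assms] by simp
  have "G (x, legendre x \<beta>) = ?s"
    using subgradient_legendre(2)[OF x, of \<beta>] G_nonneg[OF x] by simp
  then show "G (x, (1 / ?s) *\<^sub>R legendre x \<beta>) = 1" using s x by (simp add: G_scale)
  have "\<beta> \<bullet> legendre x \<beta> = ?s * ?s" using dual_sq_pos[OF assms] by (simp add: dual_sq_def)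
  then show "\<beta> \<bullet> (1 / ?s) *\<^sub>R legendre x \<beta> = ?s" using s by (simp del: real_sqrt_mult_self)
qed

section \<open>Joint regularity in base point and covector\<close>

lemma K_lower_bound:
  assumes "cball x0 r \<subseteq> W"
  shows "\<exists>m>0. \<forall>x\<in>cball x0 r. \<forall>w. (K (x, w))\<^sup>2 \<ge> m * (norm w)\<^sup>2"
proof (cases "cball x0 r = {}")
  case True
  then show ?thesis by (intro exI[of _ 1]) auto
next
  case False
  have "\<exists>z\<in>cball x0 r \<times> sphere 0 1. \<forall>w\<in>cball x0 r \<times> sphere 0 1. K z \<le> K w"
  proof (rule continuous_attains_inf)
    show "cball x0 r \<times> sphere (0::real^'n) 1 \<noteq> {}" using False by simp
    show "continuous_on (cball x0 r \<times> sphere 0 1) K"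
      by (rule continuous_on_subset[OF K_cont]) (use assms in auto)
  qed (intro compact_Times compact_cball compact_sphere)
  then obtain x1 u1 where 1: "x1 \<in> cball x0 r" "u1 \<in> sphere 0 1"
    "\<And>x u. x \<in> cball x0 r \<Longrightarrow> u \<in> sphere 0 1 \<Longrightarrow> K (x1, u1) \<le> K (x, u)" by auto
  have K: "asymmetric_norm UNIV (\<lambda>y. K (x, y))" if "x \<in> cball x0 r" for x
    using K_norm assms that by blast
  have "u1 \<noteq> 0" using 1 by auto
  then have pos: "K (x1, u1) > 0"
    using K[OF 1(1)] by (auto simp: asymmetric_norm_def order.order_iff_strict)
  have "(K (x1, u1))\<^sup>2 * (norm w)\<^sup>2 \<le> (K (x, w))\<^sup>2" if x: "x \<in> cball x0 r" for x w
  proof (cases "w = 0")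
    case False
    have "K (x, w) = K (x, norm w *\<^sub>R ((1 / norm w) *\<^sub>R w))" using False by simp
    also have "\<dots> = norm w * K (x, (1 / norm w) *\<^sub>R w)"
      using K[OF x] False unfolding asymmetric_norm_def by (metis UNIV_I zero_less_norm_iff)
    also have "\<dots> \<ge> norm w * K (x1, u1)"
      by (rule mult_left_mono[OF 1(3)[OF x]]) (use False in auto)
    finally have "(norm w * K (x1, u1))\<^sup>2 \<le> (K (x, w))\<^sup>2"
      by (rule power_mono) (use pos in simp)
    then show ?thesis by (simp add: power_mult_distrib mult.commute)
  qed simp
  then show ?thesis using pos by (intro exI[of _ "(K (x1, u1))\<^sup>2"]) auto
qed

text \<open>With \<open>y = legendre x \<beta>\<close>, strong convexity tested at
  \<open>z = 0\<close> and Euler's relation leave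
  \<open>(K (x, - y))\<^sup>2 \<le> \<beta> \<bullet> y\<close>.\<close>

lemma legendre_bound:
  assumes x: "x \<in> W" and m: "m > 0" "\<And>w. (K (x, w))\<^sup>2 \<ge> m * (norm w)\<^sup>2"
  shows "norm (legendre x \<beta>) \<le> norm \<beta> / m"
proof -
  let ?y = "legendre x \<beta>"
  have "m * (norm ?y)\<^sup>2 \<le> (K (x, 0 - ?y))\<^sup>2" using m(2)[of "0 - ?y"] by simp
  also have "\<dots> \<le> \<beta> \<bullet> ?y"
    using subgradient_strong[OF x subgradient_legendre(1)[OF x, of \<beta>], of 0] G_eq_0[OF x, of 0]
      subgradient_legendre(2)[OF x, of \<beta>] by (simp add: dual_sq_def)
  also have "\<dots> \<le> norm \<beta> * norm ?y" by (rule norm_cauchy_schwarz)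
  finally have "norm ?y * (m * norm ?y) \<le> norm ?y * norm \<beta>"
    by (simp add: power2_eq_square mult_ac)
  then have "m * norm ?y \<le> norm \<beta>" by (cases "?y = 0") auto
  then show ?thesis using m(1) by (simp add: pos_le_divide_eq mult.commute)
qed

text \<open>A quantitative version of \<open>subgradient_unique\<close> for two different base
  points and covectors.\<close>

lemma legendre_lipschitz: "locally_lipschitz_on (W \<times> UNIV) (\<lambda>(x, \<beta>). legendre x \<beta>)"
  unfolding locally_lipschitz_on_def
proof
  fix z0 assume "z0 \<in> W \<times> (UNIV :: (real^'n) set)"
  then obtain x0 \<beta>0 where z0: "z0 = (x0, \<beta>0)" "x0 \<in> W" by auto
  obtain r where r: "r > 0" "cball x0 r \<subseteq> W" using open_W z0(2) open_contains_cball by blast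
  obtain m where m: "m > 0" "\<And>x w. x \<in> cball x0 r \<Longrightarrow> (K (x, w))\<^sup>2 \<ge> m * (norm w)\<^sup>2"
    using K_lower_bound[OF r(2)] by blast
  \<comment> \<open>By \<open>legendre_bound\<close>, the maximizers for base points in
    \<open>cball x0 r\<close> and covectors within distance 1 of \<open>\<beta>0\<close> have norm
    at most \<open>R\<close>.\<close>
  define R where "R = (norm \<beta>0 + 1) / m"
  \<comment> \<open>The local bounds for \<open>g\<close> in both variables are weakened to bounds
    in \<open>y\<close> alone, which compactness of the two balls makes uniform.\<close>
  have "local_lipschitz (cball x0 r) (cball 0 R) (\<lambda>x y. g (x, y))"
  proof (rule local_lipschitzI)
    fix x y assume xy: "x \<in> cball x0 r" "y \<in> cball (0::real^'n) R"
    then have "(x, y) \<in> W \<times> UNIV" using r(2) by auto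
    then obtain s L where s: "s > 0" "L-lipschitz_on (ball (x, y) s \<inter> W \<times> UNIV) g"
      using lipschitz unfolding locally_lipschitz_on_def by blast
    have "L-lipschitz_on (cball y (s/3) \<inter> cball 0 R) (\<lambda>y. g (x', y))"
      if x': "x' \<in> cball x (s/3) \<inter> cball x0 r" for x'
    proof (rule lipschitz_onI)
      show "0 \<le> L" using s lipschitz_on_nonneg by blast
      fix a b assume "a \<in> cball y (s/3) \<inter> cball 0 R" "b \<in> cball y (s/3) \<inter> cball 0 R"
      then have "dist (x, y) (x', a) < s" "dist (x, y) (x', b) < s"
        using x' s(1) dist_Pair_Pair[of x y x' a] dist_Pair_Pair[of x y x' b]
          sqrt_sum_squares_le_sum[of "dist x x'" "dist y a"] sqrt_sum_squares_le_sum[of "dist x x'" "dist y b"]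
        by auto
      then have "dist (g (x', a)) (g (x', b)) \<le> L * dist (x', a) (x', b)"
        using x' r(2) by (intro lipschitz_onD[OF s(2)]) auto
      then show "dist (g (x', a)) (g (x', b)) \<le> L * dist a b" by (simp add: dist_Pair_Pair)
    qed
    then show "\<exists>u>0. \<exists>L. \<forall>t\<in>cball x u \<inter> cball x0 r. L-lipschitz_on (cball y u \<inter> cball 0 R) (\<lambda>y. g (t, y))"
      using s(1) by (intro exI[of _ "s/3"] exI[of _ L] conjI ballI) auto
  qed
  moreover have "continuous_on (cball x0 r) (\<lambda>x. g (x, y))" for y
    by (rule continuous_on_compose2[OF locally_lipschitz_on_imp_continuous_on[OF lipschitz]])
      (use r in \<open>auto intro!: continuous_intros\<close>)
  ultimately obtain L where L: "\<And>x. x \<in> cball x0 r \<Longrightarrow> L-lipschitz_on (cball 0 R) (\<lambda>y. g (x, y))"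
    by (rule local_lipschitz_compact_implies_lipschitz[where f = "\<lambda>x y. g (x, y)", OF _ compact_cball compact_cball]) blast
  have L0: "L \<ge> 0" using L[of x0] r(1) lipschitz_on_nonneg by force
  have "((2 + L) / (2 * m))-lipschitz_on (ball z0 (min r 1) \<inter> W \<times> UNIV) (\<lambda>(x, \<beta>). legendre x \<beta>)"
  proof (rule lipschitz_onI)
    show "0 \<le> (2 + L) / (2 * m)" using L0 m(1) by simp
    fix z1 z2 assume *: "z1 \<in> ball z0 (min r 1) \<inter> W \<times> UNIV" "z2 \<in> ball z0 (min r 1) \<inter> W \<times> UNIV"
    obtain x1 \<beta>1 x2 \<beta>2 where z: "z1 = (x1, \<beta>1)" "z2 = (x2, \<beta>2)" by (cases z1, cases z2)
    have d1: "dist x0 x1 \<le> dist z0 z1" "dist \<beta>0 \<beta>1 \<le> dist z0 z1"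
      using dist_fst_le[of z0 z1] dist_snd_le[of z0 z1] by (auto simp: z z0)
    have d2: "dist x0 x2 \<le> dist z0 z2" "dist \<beta>0 \<beta>2 \<le> dist z0 z2"
      using dist_fst_le[of z0 z2] dist_snd_le[of z0 z2] by (auto simp: z z0)
    have x: "x1 \<in> cball x0 r" "x2 \<in> cball x0 r" using d1 d2 * by auto
    then have xW: "x1 \<in> W" "x2 \<in> W" using r(2) by auto
    have b: "norm \<beta>1 \<le> norm \<beta>0 + 1" "norm \<beta>2 \<le> norm \<beta>0 + 1"
      using d1 d2 * norm_triangle_sub[of \<beta>1 \<beta>0] norm_triangle_sub[of \<beta>2 \<beta>0]
      by (auto simp: dist_norm norm_minus_commute)
    define y1 where "y1 = legendre x1 \<beta>1"
    define y2 where "y2 = legendre x2 \<beta>2"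
    have y: "y1 \<in> cball 0 R" "y2 \<in> cball 0 R"
    proof -
      have "norm y1 \<le> norm \<beta>1 / m" "norm y2 \<le> norm \<beta>2 / m"
        unfolding y1_def y2_def using legendre_bound[OF xW(1) m(1) m(2)[OF x(1)]]
          legendre_bound[OF xW(2) m(1) m(2)[OF x(2)]] by auto
      then show "y1 \<in> cball 0 R" "y2 \<in> cball 0 R"
        using b m(1) divide_right_mono[OF b(1), of m] divide_right_mono[OF b(2), of m] by (auto simp: R_def)
    qed
    \<comment> \<open>Its gradient \<open>g (x, y2) - g (x, y1)\<close> has norm at most
      \<open>L * norm (y2 - y1)\<close>, so the comparison of \<open>D\<close> at \<open>x1\<close>
      and \<open>x2\<close> keeps the factor \<open>norm (y2 - y1)\<close> that is cancelled at the
      end.\<close>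
    define D where "D = (\<lambda>x. (G (x, y2))\<^sup>2 - (G (x, y1))\<^sup>2)"
    have D: "norm (D x1 - D x2) \<le> (L * norm (y2 - y1)) * norm (x1 - x2)"
    proof (rule differentiable_bound[OF convex_cball[of x0 r]])
      fix x assume xx: "x \<in> cball x0 r"
      show "(D has_derivative (\<lambda>h. (g (x, y2) - g (x, y1)) \<bullet> h)) (at x within cball x0 r)"
        unfolding D_def inner_diff_left
        by (rule has_derivative_at_withinI[OF has_derivative_diff[OF has_derivative_G_sq has_derivative_G_sq]]) (use xx r(2) in auto)
      show "onorm (\<lambda>h. (g (x, y2) - g (x, y1)) \<bullet> h) \<le> L * norm (y2 - y1)"
      proof (rule onorm_bound)
        fix h
        have "norm ((g (x, y2) - g (x, y1)) \<bullet> h) \<le> norm (g (x, y2) - g (x, y1)) * norm h"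
          by (simp add: Cauchy_Schwarz_ineq2)
        also have "\<dots> \<le> (L * norm (y2 - y1)) * norm h"
          using lipschitz_onD[OF L[OF xx] y(2,1)] by (intro mult_right_mono) (auto simp: dist_norm)
        finally show "norm ((g (x, y2) - g (x, y1)) \<bullet> h) \<le> (L * norm (y2 - y1)) * norm h" .
      qed (use L0 in simp)
    qed (use x in auto)
    \<comment> \<open>Strong convexity over \<open>x1\<close> at \<open>y1\<close> tested with
      \<open>y2\<close>, then over \<open>x2\<close> with the roles exchanged: the sum contains
      \<open>G\<close> only through \<open>D x1 - D x2\<close>.\<close>
    have "m * (norm (y2 - y1))\<^sup>2 \<le> (G (x1, y2))\<^sup>2 - (G (x1, y1))\<^sup>2 - 2 * (\<beta>1 \<bullet> (y2 - y1))"
      using subgradient_strong[OF xW(1) subgradient_legendre(1)[OF xW(1), of \<beta>1], of y2] m(2)[OF x(1), of "y2 - y1"]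
      by (simp add: y1_def)
    moreover have "m * (norm (y2 - y1))\<^sup>2 \<le> (G (x2, y1))\<^sup>2 - (G (x2, y2))\<^sup>2 + 2 * (\<beta>2 \<bullet> (y2 - y1))"
      using subgradient_strong[OF xW(2) subgradient_legendre(1)[OF xW(2), of \<beta>2], of y1] m(2)[OF x(2), of "y1 - y2"]
      by (simp add: y2_def norm_minus_commute inner_diff_right)
    ultimately have "2 * m * (norm (y2 - y1))\<^sup>2 \<le> D x1 - D x2 + 2 * ((\<beta>2 - \<beta>1) \<bullet> (y2 - y1))"
      by (simp add: D_def inner_diff_left)
    also have "\<dots> \<le> L * norm (y2 - y1) * norm (x1 - x2) + 2 * (norm (\<beta>2 - \<beta>1) * norm (y2 - y1))"
      using D by (intro add_mono mult_left_mono norm_cauchy_schwarz) auto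
    also have "\<dots> = norm (y2 - y1) * (L * dist x1 x2 + 2 * dist \<beta>1 \<beta>2)"
      by (simp add: dist_norm norm_minus_commute algebra_simps)
    also have "\<dots> \<le> norm (y2 - y1) * (L * dist z1 z2 + 2 * dist z1 z2)"
      using dist_fst_le[of z1 z2] dist_snd_le[of z1 z2] L0
      by (intro mult_left_mono add_mono) (auto simp: z)
    finally have "norm (y2 - y1) * (2 * m * norm (y2 - y1)) \<le> norm (y2 - y1) * ((2 + L) * dist z1 z2)"
      by (simp add: power2_eq_square algebra_simps)
    then have "2 * m * norm (y2 - y1) \<le> (2 + L) * dist z1 z2"
      using L0 by (cases "y2 = y1") auto
    then show "dist (case z1 of (x, \<beta>) \<Rightarrow> legendre x \<beta>) (case z2 of (x, \<beta>) \<Rightarrow> legendre x \<beta>)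
        \<le> (2 + L) / (2 * m) * dist z1 z2"
      using m(1) by (simp add: z y1_def[symmetric] y2_def[symmetric] dist_norm norm_minus_commute field_simps)
  qed
  then show "\<exists>r>0. \<exists>L. L-lipschitz_on (ball z0 r \<inter> W \<times> UNIV) (\<lambda>(x, \<beta>). legendre x \<beta>)"
    using r(1) by (intro exI[of _ "min r 1"]) auto
qed

text \<open>The envelope theorem: \<open>dual_sq x \<beta>\<close> is the maximum over \<open>y\<close> of \<open>2 (\<beta> \<bullet> y) - (G (x, y))\<^sup>2\<close>, so only
  the explicit dependence on \<open>(x, \<beta>)\<close> contributes to its derivative.\<close>

lemma has_derivative_dual_sq:
  assumes x0: "x0 \<in> W"
  shows "((\<lambda>z. dual_sq (fst z) (snd z)) has_derivative
    (\<lambda>h. 2 * (legendre x0 \<beta>0 \<bullet> snd h) - g (x0, legendre x0 \<beta>0) \<bullet> fst h)) (at (x0, \<beta>0))"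
  unfolding has_derivative_at_alt
proof (intro conjI allI impI)
  let ?y0 = "legendre x0 \<beta>0"
  let ?D = "\<lambda>h. 2 * (?y0 \<bullet> snd h) - g (x0, ?y0) \<bullet> fst h"
  show "bounded_linear ?D"
    by (intro bounded_linear_sub bounded_linear_const_mult bounded_linear_inner_right_comp bounded_linear_fst bounded_linear_snd)
  fix e :: real assume e: "e > 0"
  obtain d1 where d1: "d1 > 0" "\<And>z. z \<in> W \<times> UNIV \<Longrightarrow> dist z (x0, ?y0) < d1 \<Longrightarrow> dist (g z) (g (x0, ?y0)) < e / 2"
    using locally_lipschitz_on_imp_continuous_on[OF lipschitz, unfolded continuous_on_iff, rule_format, of "(x0, ?y0)" "e / 2"]
      x0 e by auto
  obtain d2 where d2: "d2 > 0" "ball x0 d2 \<subseteq> W" using open_W x0 by (meson openE)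
  \<comment> \<open>\<open>d1 / 2\<close> keeps \<open>(x', y)\<close> within \<open>d1\<close> of
    \<open>(x0, ?y0)\<close>; \<open>e / 4\<close> makes the mixed term
    \<open>2 * ((\<beta> - \<beta>0) \<bullet> (y - ?y0))\<close> cost at most \<open>e / 2\<close>
    times the distance.\<close>
  define d3 where "d3 = min (d1 / 2) (e / 4)"
  have d3: "d3 > 0" using d1 e by (simp add: d3_def)
  obtain d4 where d4: "d4 > 0" "\<And>z. z \<in> W \<times> UNIV \<Longrightarrow> dist z (x0, \<beta>0) < d4 \<Longrightarrow>
      dist (legendre (fst z) (snd z)) ?y0 < d3"
    using locally_lipschitz_on_imp_continuous_on[OF legendre_lipschitz, unfolded continuous_on_iff, rule_format, of "(x0, \<beta>0)" d3]
      x0 d3 by (auto simp: case_prod_beta)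
  define d where "d = min d2 (min d4 (d1 / 2))"
  \<comment> \<open>For fixed \<open>y\<close> the increment of the function being maximized is
    close to \<open>?D\<close>, uniformly for \<open>y\<close> near \<open>?y0\<close>.\<close>
  have est: "\<bar>(2 * (\<beta> \<bullet> y) - (G (x, y))\<^sup>2) - (2 * (\<beta>0 \<bullet> y) - (G (x0, y))\<^sup>2) - ?D ((x, \<beta>) - (x0, \<beta>0))\<bar>
      \<le> e * norm ((x, \<beta>) - (x0, \<beta>0))"
    if y: "dist y ?y0 < d3" and z: "dist (x, \<beta>) (x0, \<beta>0) < d" for x \<beta> y
  proof -
    define q where "q = (\<lambda>x. (G (x, y))\<^sup>2 - g (x0, ?y0) \<bullet> x)"
    let ?r = "dist (x, \<beta>) (x0, \<beta>0)"
    have nx: "norm (x - x0) \<le> ?r" and nb: "norm (\<beta> - \<beta>0) \<le> ?r"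
      using dist_fst_le[of "(x, \<beta>)" "(x0, \<beta>0)"] dist_snd_le[of "(x, \<beta>)" "(x0, \<beta>0)"] by (auto simp: dist_norm)
    have "norm (q x - q x0) \<le> e / 2 * norm (x - x0)"
    proof (rule differentiable_bound[OF convex_ball[of x0 d]])
      fix x' assume x': "x' \<in> ball x0 d"
      then have xW: "x' \<in> W" using d2(2) by (auto simp: d_def)
      show "(q has_derivative (\<lambda>h. g (x', y) \<bullet> h - g (x0, ?y0) \<bullet> h)) (at x' within ball x0 d)"
        unfolding q_def by (rule has_derivative_at_withinI[OF has_derivative_diff[OF has_derivative_G_sq[OF xW]
            bounded_linear_imp_has_derivative[OF bounded_linear_inner_right]]])
      have "dist (x', y) (x0, ?y0) \<le> dist x' x0 + dist y ?y0"
        by (simp add: dist_Pair_Pair sqrt_sum_squares_le_sum)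
      also have "\<dots> < d1" using x' y by (auto simp: d_def d3_def dist_commute)
      finally have "norm (g (x', y) - g (x0, ?y0)) \<le> e / 2"
        using d1(2)[of "(x', y)"] xW by (simp add: dist_norm)
      then show "onorm (\<lambda>h. g (x', y) \<bullet> h - g (x0, ?y0) \<bullet> h) \<le> e / 2"
        unfolding inner_diff_left[symmetric]
        using e by (intro onorm_bound) (auto simp only: real_norm_def intro!: order_trans[OF Cauchy_Schwarz_ineq2] mult_right_mono norm_ge_zero)
    qed (use nx z d3 d2(1) d4(1) d1(1) in \<open>auto simp: dist_norm norm_minus_commute d_def\<close>)
    also have "\<dots> \<le> e / 2 * ?r" using nx e by simp
    finally have 1: "\<bar>q x - q x0\<bar> \<le> e / 2 * ?r" by simp
    have "\<bar>2 * ((\<beta> - \<beta>0) \<bullet> (y - ?y0))\<bar> \<le> 2 * (norm (\<beta> - \<beta>0) * norm (y - ?y0))"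
      using Cauchy_Schwarz_ineq2[of "\<beta> - \<beta>0" "y - ?y0"] by simp
    also have "\<dots> \<le> 2 * (?r * (e / 4))"
      using y nb by (intro mult_left_mono mult_mono) (auto simp: d3_def dist_norm)
    finally have 2: "\<bar>2 * ((\<beta> - \<beta>0) \<bullet> (y - ?y0))\<bar> \<le> e / 2 * ?r" by simp
    have "(2 * (\<beta> \<bullet> y) - (G (x, y))\<^sup>2) - (2 * (\<beta>0 \<bullet> y) - (G (x0, y))\<^sup>2) - ?D ((x, \<beta>) - (x0, \<beta>0))
        = 2 * ((\<beta> - \<beta>0) \<bullet> (y - ?y0)) - (q x - q x0)"
      by (simp add: q_def inner_diff_left inner_diff_right inner_commute algebra_simps)
    also have "\<bar>\<dots>\<bar> \<le> e / 2 * ?r + e / 2 * ?r" using 1 2 by linarith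
    finally show ?thesis by (simp add: dist_norm)
  qed
  have "norm (dual_sq (fst z) (snd z) - dual_sq (fst (x0, \<beta>0)) (snd (x0, \<beta>0)) - ?D (z - (x0, \<beta>0)))
      \<le> e * norm (z - (x0, \<beta>0))" if z: "norm (z - (x0, \<beta>0)) < d" for z
  proof -
    obtain x \<beta> where zz: "z = (x, \<beta>)" by (cases z)
    have dz: "dist (x, \<beta>) (x0, \<beta>0) < d" using z by (simp add: dist_norm zz)
    have xW: "x \<in> W"
      using d2(2) dz dist_fst_le[of "(x, \<beta>)" "(x0, \<beta>0)"] by (auto simp: d_def dist_commute)
    have y: "dist (legendre x \<beta>) ?y0 < d3" using d4(2)[of "(x, \<beta>)"] xW dz by (simp add: d_def)
    \<comment> \<open>The increment of the maximum lies between the increments at the two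
      maximizers: \<open>?y0\<close> gives the lower bound and \<open>legendre x \<beta>\<close> the
      upper one. Only the continuity of \<open>legendre\<close> enters.\<close>
    show ?thesis
      using est[OF y dz] est[of ?y0, OF _ dz] d3
        dual_sq_eq[OF xW, of \<beta>] dual_sq_eq[OF x0, of \<beta>0]
        dual_sq_ge[OF xW, of \<beta> ?y0] dual_sq_ge[OF x0, of \<beta>0 "legendre x \<beta>"]
      by (simp add: zz)
  qed
  then show "\<exists>d>0. \<forall>z. norm (z - (x0, \<beta>0)) < d \<longrightarrow>
      norm (dual_sq (fst z) (snd z) - dual_sq (fst (x0, \<beta>0)) (snd (x0, \<beta>0)) - ?D (z - (x0, \<beta>0)))
      \<le> e * norm (z - (x0, \<beta>0))"
    using d2(1) d4(1) d1(1) by (intro exI[of _ d]) (auto simp: d_def)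
qed

end

subsection \<open>Coordinates on the cotangent bundle\<close>

lemma scaleR_fun_apply: "(r *\<^sub>R f) x = r *\<^sub>R f x"
  by (simp add: scaleR_fun_def)

lemma has_derivative_vec_lambda:
  fixes f :: "'n::finite \<Rightarrow> 'a::real_normed_vector \<Rightarrow> real"
  assumes "\<And>i. (f i has_derivative D i) (at x within S)"
  shows "((\<lambda>x. \<chi> i. f i x) has_derivative (\<lambda>h. \<chi> i. D i h)) (at x within S)"
  using assms by (subst has_derivative_componentwise_within) (auto simp: Basis_vec_def inner_axis)

lemma linear_vec_sum:
  fixes h :: "real^'n \<Rightarrow> 'b::real_vector"
  assumes "linear h"
  shows "h y = (\<Sum>i\<in>UNIV. (y $ i) *\<^sub>R h (axis i 1))"
proof -
  have "h y = h (\<Sum>i\<in>UNIV. (y $ i) *\<^sub>R axis i 1)" by (simp add: basis_expansion scalar_mult_eq_scaleR[symmetric])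
  then show ?thesis using assms by (simp add: linear_sum linear_cmul)
qed

text \<open>Collects what tangent spaces require of an atlas, so as to cover both \<open>A\<close>
  and its cotangent atlas; no topology on the total space is involved.\<close>

locale differentiable_atlas =
  fixes C :: "('b, 'e::euclidean_space) chart set"
  assumes inj: "c \<in> C \<Longrightarrow> inj_on (snd c) (fst c)"
    and open_overlap: "c \<in> C \<Longrightarrow> d \<in> C \<Longrightarrow> open (snd c ` (fst c \<inter> fst d))"
    and differentiable: "c \<in> C \<Longrightarrow> d \<in> C \<Longrightarrow> z \<in> fst c \<Longrightarrow> z \<in> fst d \<Longrightarrow>
      transition c d differentiable (at (snd c z))"
begin

abbreviation D :: "('b, 'e) chart \<Rightarrow> ('b, 'e) chart \<Rightarrow> 'b \<Rightarrow> 'e \<Rightarrow> 'e" where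
  "D c d z \<equiv> frechet_derivative (transition c d) (at (snd c z))"

lemma chart_inv: "c \<in> C \<Longrightarrow> z \<in> fst c \<Longrightarrow> chart_inv c (snd c z) = z"
  by (simp add: chart_inv_def the_inv_into_f_f inj)

lemma transition: "c \<in> C \<Longrightarrow> z \<in> fst c \<Longrightarrow> transition c d (snd c z) = snd d z"
  by (simp add: transition_def chart_inv)

lemma has_derivative_transition:
  "c \<in> C \<Longrightarrow> d \<in> C \<Longrightarrow> z \<in> fst c \<Longrightarrow> z \<in> fst d \<Longrightarrow>
    (transition c d has_derivative D c d z) (at (snd c z))"
  using differentiable by (simp add: frechet_derivative_works[symmetric])

lemma linear_D: "c \<in> C \<Longrightarrow> d \<in> C \<Longrightarrow> z \<in> fst c \<Longrightarrow> z \<in> fst d \<Longrightarrow> linear (D c d z)"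
  using has_derivative_transition has_derivative_linear by blast

lemma D_cocycle:
  assumes c: "c \<in> C" "z \<in> fst c" and d: "d \<in> C" "z \<in> fst d" and e: "e \<in> C" "z \<in> fst e"
  shows "D d e z (D c d z y) = D c e z y"
proof -
  have "(transition d e has_derivative D d e z) (at (transition c d (snd c z)))"
    using has_derivative_transition[OF d(1) e(1) d(2) e(2)] by (simp add: transition c)
  from has_derivative_compose[OF has_derivative_transition[OF c(1) d(1) c(2) d(2)] this]
  have "((\<lambda>x. transition d e (transition c d x)) has_derivative (\<lambda>y. D d e z (D c d z y))) (at (snd c z))" .
  then have "(transition c e has_derivative (\<lambda>y. D d e z (D c d z y))) (at (snd c z))"
    by (rule has_derivative_transform_within_open[OF _ open_overlap[OF c(1) d(1)]])
      (use c d in \<open>auto simp: transition\<close>)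
  with has_derivative_transition[OF c(1) e(1) c(2) e(2)] show ?thesis
    by (metis has_derivative_unique)
qed

lemma D_id:
  assumes c: "c \<in> C" "z \<in> fst c"
  shows "D c c z y = y"
proof -
  have "(transition c c has_derivative (\<lambda>y. y)) (at (snd c z))"
    by (rule has_derivative_transform_within_open[OF has_derivative_ident open_overlap[OF c(1) c(1)]])
      (use c in \<open>auto simp: transition\<close>)
  with has_derivative_transition[OF c(1) c(1) c(2) c(2)] show ?thesis
    by (metis has_derivative_unique)
qed

lemma tangent_space_D:
  "v \<in> tangent_space C z \<Longrightarrow> c \<in> C \<Longrightarrow> z \<in> fst c \<Longrightarrow> d \<in> C \<Longrightarrow> z \<in> fst d \<Longrightarrow> v d = D c d z (v c)"
  unfolding tangent_space_def by blast

text \<open>The derivatives of the transitions carry any \<open>y\<close> to all other charts around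
  the point, consistently by \<open>D_cocycle\<close>, and the remaining index values are fixed to
  0.\<close>

lemma coord_bij:
  assumes c: "c \<in> C" "z \<in> fst c"
  shows "bij_betw (\<lambda>v. v c) (tangent_space C z) UNIV"
proof (rule bij_betwI')
  fix v w assume v: "v \<in> tangent_space C z" and w: "w \<in> tangent_space C z"
  have "v d = w d" if "v c = w c" for d
  proof (cases "d \<in> C \<and> z \<in> fst d")
    case True
    then show ?thesis using tangent_space_D[OF v c] tangent_space_D[OF w c] that by simp
  next
    case False
    then have "v d = 0" "w d = 0" using v w unfolding tangent_space_def by blast+
    then show ?thesis by simp
  qed
  then show "(v c = w c) = (v = w)" by auto
next
  fix y :: 'e
  let ?v = "\<lambda>d. if d \<in> C \<and> z \<in> fst d then D c d z y else 0"
  have 1: "?v \<in> tangent_space C z"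
    unfolding tangent_space_def using D_cocycle[OF c] by auto
  have 2: "y = ?v c" using c by (simp add: D_id)
  show "\<exists>v\<in>tangent_space C z. y = v c" by (rule bexI[OF _ 1]) (rule 2)
qed auto

lemma coord_vector:
  assumes "c \<in> C" "z \<in> fst c"
  shows "coord_vector C c z y \<in> tangent_space C z" "(coord_vector C c z y) c = y"
    "v \<in> tangent_space C z \<Longrightarrow> coord_vector C c z (v c) = v"
proof -
  have b: "inj_on (\<lambda>v. v c) (tangent_space C z)" "(\<lambda>v. v c) ` tangent_space C z = UNIV"
    using coord_bij[OF assms] by (simp_all add: bij_betw_def)
  show "coord_vector C c z y \<in> tangent_space C z"
    unfolding coord_vector_def by (rule the_inv_into_into[OF b(1)]) (simp_all add: b(2))
  show "(coord_vector C c z y) c = y"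
    unfolding coord_vector_def by (rule f_the_inv_into_f[OF b(1)]) (simp add: b(2))
  show "coord_vector C c z (v c) = v" if "v \<in> tangent_space C z"
    unfolding coord_vector_def using the_inv_into_f_f[OF b(1) that] .
qed

lemma tangent_space_eqI:
  assumes "c \<in> C" "z \<in> fst c" "v \<in> tangent_space C z" "w \<in> tangent_space C z" "v c = w c"
  shows "v = w"
  using coord_vector(3)[OF assms(1,2)] assms(3-5) by metis

lemma tangent_space_scaleR_add:
  assumes "v \<in> tangent_space C z" "w \<in> tangent_space C z"
  shows "r *\<^sub>R v + s *\<^sub>R w \<in> tangent_space C z"
  unfolding tangent_space_def
proof (intro CollectI conjI ballI allI impI)
  fix c d assume *: "c \<in> C" "d \<in> C" "z \<in> fst c \<and> z \<in> fst d"
  then show "(r *\<^sub>R v + s *\<^sub>R w) d = D c d z ((r *\<^sub>R v + s *\<^sub>R w) c)"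
    using assms[THEN tangent_space_D, of c d]
    by (simp add: scaleR_fun_apply linear_add[OF linear_D] linear_cmul[OF linear_D])
next
  fix c assume *: "\<not> (c \<in> C \<and> z \<in> fst c)"
  then have "v c = 0" "w c = 0" using assms unfolding tangent_space_def by blast+
  then show "(r *\<^sub>R v + s *\<^sub>R w) c = 0" by (simp add: scaleR_fun_apply)
qed

lemma tangent_space_subspace: "subspace (tangent_space C z)"
proof (rule subspaceI)
  show "0 \<in> tangent_space C z" unfolding tangent_space_def by (simp add: linear_0[OF linear_D])
next
  fix v w assume "v \<in> tangent_space C z" "w \<in> tangent_space C z"
  then show "v + w \<in> tangent_space C z" using tangent_space_scaleR_add[of v z w 1 1] by simp
next
  fix r v assume "v \<in> tangent_space C z"
  then show "r *\<^sub>R v \<in> tangent_space C z" using tangent_space_scaleR_add[of v z v r 0] by simp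
qed

lemma coord_vector_linear:
  assumes "c \<in> C" "z \<in> fst c"
  shows "linear (coord_vector C c z)"
proof (rule linearI)
  fix x y r
  show "coord_vector C c z (x + y) = coord_vector C c z x + coord_vector C c z y"
    by (rule tangent_space_eqI[OF assms])
      (simp_all add: coord_vector[OF assms] subspace_add[OF tangent_space_subspace])
  show "coord_vector C c z (r *\<^sub>R x) = r *\<^sub>R coord_vector C c z x"
    by (rule tangent_space_eqI[OF assms])
      (simp_all add: coord_vector[OF assms] subspace_scale[OF tangent_space_subspace] scaleR_fun_apply)
qed

end

locale smooth_atlas =
  fixes A :: "('a::{t2_space, second_countable_topology}, real^'n) chart set"
  assumes manifold: "smooth_manifold A"
begin

lemma chart_homeomorphism:
  assumes "c \<in> A"
  shows "open (fst c)" "open (chart_image c)" "homeomorphism (fst c) (chart_image c) (snd c) (chart_inv c)"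
  using manifold assms unfolding smooth_manifold_def is_chart_def by blast+

lemma open_overlap':
  assumes "c \<in> A" "d \<in> A"
  shows "open (snd c ` (fst c \<inter> fst d))"
proof -
  have "openin (top_of_set (chart_image c)) (snd c ` (fst c \<inter> fst d))"
    using chart_homeomorphism[OF assms(1)] chart_homeomorphism[OF assms(2)]
    by (intro homeomorphism_imp_open_map) (auto intro: openin_open_Int)
  then show ?thesis using chart_homeomorphism(2)[OF assms(1)] openin_open_trans by blast
qed

lemma smooth_transition: "c \<in> A \<Longrightarrow> d \<in> A \<Longrightarrow> smooth_on (snd c ` (fst c \<inter> fst d)) (transition c d)"
  using manifold unfolding smooth_manifold_def compatible_def by blast

sublocale differentiable_atlas A
proof
  fix c d assume c: "c \<in> A"
  show "inj_on (snd c) (fst c)"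
    by (rule inj_on_inverseI[where g = "chart_inv c"]) (use chart_homeomorphism(3)[OF c] in \<open>simp add: homeomorphism_apply1\<close>)
  assume d: "d \<in> A"
  show "open (snd c ` (fst c \<inter> fst d))" by (rule open_overlap'[OF c d])
  fix z assume "z \<in> fst c" "z \<in> fst d"
  then show "transition c d differentiable at (snd c z)"
    by (intro differentiableI[OF smooth_on_differentiable[OF smooth_transition[OF c d]]]) auto
qed

section \<open>Covectors and their coordinates\<close>

lemma covec_inner:
  assumes c: "c \<in> A" "p \<in> fst c" and \<alpha>: "\<alpha> \<in> dual_space (tangent_space A p)" and v: "v \<in> tangent_space A p"
  shows "\<alpha> v = covec_coords A c p \<alpha> \<bullet> v c"
proof -
  have add: "\<alpha> (v + w) = \<alpha> v + \<alpha> w" if "v \<in> tangent_space A p" "w \<in> tangent_space A p" for v w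
    using \<alpha> that unfolding dual_space_def by blast
  have scale: "\<alpha> (r *\<^sub>R v) = r * \<alpha> v" if "v \<in> tangent_space A p" for v r
    using \<alpha> that unfolding dual_space_def by blast
  have "linear (\<lambda>y. \<alpha> (coord_vector A c p y))"
  proof (rule linearI)
    show "\<alpha> (coord_vector A c p (x + y)) = \<alpha> (coord_vector A c p x) + \<alpha> (coord_vector A c p y)" for x y
      unfolding linear_add[OF coord_vector_linear[OF c]] by (intro add coord_vector c)
    show "\<alpha> (coord_vector A c p (r *\<^sub>R x)) = r *\<^sub>R \<alpha> (coord_vector A c p x)" for r x
      unfolding linear_cmul[OF coord_vector_linear[OF c]] real_scaleR_def by (intro scale coord_vector c)
  qed
  from linear_vec_sum[OF this, of "v c"] show ?thesis
    by (simp add: coord_vector(3)[OF c v] covec_coords_def inner_vec_def mult.commute)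
qed

text \<open>Inverse of \<open>covec_coords\<close>; the value 0 off the tangent space is the one
  demanded by \<open>dual_space\<close>.\<close>

definition covec :: "('a, real^'n) chart \<Rightarrow> 'a \<Rightarrow> real^'n \<Rightarrow> ('a, real^'n) covec" where
  "covec c p a = (\<lambda>v. if v \<in> tangent_space A p then a \<bullet> v c else 0)"

lemma covec:
  assumes c: "c \<in> A" "p \<in> fst c"
  shows "covec c p a \<in> dual_space (tangent_space A p)" "covec_coords A c p (covec c p a) = a"
proof -
  show "covec c p a \<in> dual_space (tangent_space A p)"
    using subspace_add[OF tangent_space_subspace] subspace_scale[OF tangent_space_subspace]
    by (auto simp: dual_space_def covec_def inner_add_right scaleR_fun_apply)
  show "covec_coords A c p (covec c p a) = a"
    by (simp add: covec_coords_def covec_def coord_vector[OF c] inner_axis vec_eq_iff)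
qed

lemma covec_coords_inj:
  assumes c: "c \<in> A" "p \<in> fst c" and \<alpha>: "\<alpha> \<in> dual_space (tangent_space A p)"
  shows "covec c p (covec_coords A c p \<alpha>) = \<alpha>"
proof
  fix v
  show "covec c p (covec_coords A c p \<alpha>) v = \<alpha> v"
    using covec_inner[OF c \<alpha>, of v] \<alpha> by (simp add: covec_def dual_space_def)
qed

lemma covec_coords_nonzero:
  assumes c: "c \<in> A" "p \<in> fst c" and \<alpha>: "\<alpha> \<in> dual_space (tangent_space A p)" "\<alpha> \<noteq> 0"
  shows "covec_coords A c p \<alpha> \<noteq> 0"
proof
  assume "covec_coords A c p \<alpha> = 0"
  then have "covec c p 0 = \<alpha>" using covec_coords_inj[OF c \<alpha>(1)] by simp
  moreover have "covec c p 0 v = 0" for v by (simp add: covec_def)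
  ultimately show False using \<alpha>(2) by auto
qed

section \<open>The cotangent atlas and its symplectic structure\<close>

abbreviation cot :: "('a, real^'n) chart \<Rightarrow> ('a \<times> ('a, real^'n) covec, (real^'n) \<times> (real^'n)) chart" where
  "cot \<equiv> cotangent_chart A"

lemma fst_cot: "(p, \<alpha>) \<in> fst (cot c) \<longleftrightarrow> p \<in> fst c \<and> \<alpha> \<in> dual_space (tangent_space A p)"
  by (auto simp: cotangent_chart_def cotangent_bundle_def)

lemma snd_cot: "snd (cot c) (p, \<alpha>) = (snd c p, covec_coords A c p \<alpha>)"
  by (simp add: cotangent_chart_def)

lemma inj_cot: "c \<in> A \<Longrightarrow> inj_on (snd (cot c)) (fst (cot c))"
  by (rule inj_on_inverseI[where g = "\<lambda>(x, a). (chart_inv c x, covec c (chart_inv c x) a)"])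
    (auto simp: fst_cot snd_cot chart_inv covec_coords_inj)

lemma chart_inv_cot:
  assumes "c \<in> A" "x \<in> chart_image c"
  shows "chart_inv (cot c) (x, a) = (chart_inv c x, covec c (chart_inv c x) a)"
proof -
  obtain p where p: "p \<in> fst c" "x = snd c p" using assms(2) by (auto simp: chart_image_def)
  have "snd (cot c) (p, covec c p a) = (x, a)" using assms(1) p by (simp add: snd_cot covec)
  then show ?thesis
    using the_inv_into_f_f[OF inj_cot[OF assms(1)], of "(p, covec c p a)"] assms p
    by (simp add: chart_inv_def[of "cot c"] chart_inv fst_cot covec)
qed

lemma image_cot:
  assumes "c \<in> A"
  shows "snd (cot c) ` (fst (cot c) \<inter> fst (cot d)) = snd c ` (fst c \<inter> fst d) \<times> UNIV" (is "?L = ?R")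
proof
  show "?L \<subseteq> ?R" by (auto simp: fst_cot snd_cot)
  show "?R \<subseteq> ?L"
  proof
    fix w assume "w \<in> ?R"
    then obtain p a where p: "p \<in> fst c" "p \<in> fst d" and w: "w = (snd c p, a)" by auto
    then show "w \<in> ?L"
      using covec[OF assms p(1), of a]
      by (intro image_eqI[of _ _ "(p, covec c p a)"]) (auto simp: fst_cot snd_cot)
  qed
qed

text \<open>Covectors pull back, so their components change by the transpose of the derivative of
  the inverse transition.\<close>

lemma transition_cot:
  assumes c: "c \<in> A" "p \<in> fst c" and d: "d \<in> A" "p \<in> fst d"
  shows "transition (cot c) (cot d) (snd c p, a) =
    (snd d p, \<chi> i. a \<bullet> D d c p (axis i 1))"
proof -
  have x: "snd c p \<in> chart_image c" using c by (simp add: chart_image_def)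
  have "transition (cot c) (cot d) (snd c p, a) = snd (cot d) (p, covec c p a)"
    by (simp add: transition_def chart_inv_cot[OF c(1) x] chart_inv c)
  also have "\<dots> = (snd d p, \<chi> i. covec c p a (coord_vector A d p (axis i 1)))"
    by (simp add: snd_cot covec_coords_def)
  also have "\<dots> = (snd d p, \<chi> i. a \<bullet> D d c p (axis i 1))"
    using tangent_space_D[OF coord_vector(1)[OF d] d c] by (simp add: covec_def coord_vector[OF d])
  finally show ?thesis .
qed

definition D2 :: "('a, real^'n) chart \<Rightarrow> ('a, real^'n) chart \<Rightarrow> 'a \<Rightarrow> real^'n \<Rightarrow> real^'n \<Rightarrow> real^'n" where
  "D2 c d p u v = frechet_derivative (\<lambda>x. frechet_derivative (transition c d) (at x) u) (at (snd c p)) v"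

lemma has_derivative_D2:
  assumes c: "c \<in> A" "p \<in> fst c" and d: "d \<in> A" "p \<in> fst d"
  shows "((\<lambda>x. frechet_derivative (transition c d) (at x) u) has_derivative D2 c d p u) (at (snd c p))"
  unfolding D2_def
  by (rule smooth_on_differentiable[OF smooth_on_frechet_derivative[OF smooth_transition[OF c(1) d(1)]]])
    (use c d in auto)

lemma D2_symmetric:
  assumes c: "c \<in> A" "p \<in> fst c" and d: "d \<in> A" "p \<in> fst d"
  shows "D2 c d p u v = D2 c d p v u"
  unfolding D2_def
  by (rule second_derivative_symmetric[OF open_overlap[OF c(1) d(1)] _ smooth_transition[OF c(1) d(1)]])
    (use c d in auto)

lemma linear_D2:
  assumes "c \<in> A" "p \<in> fst c" "d \<in> A" "p \<in> fst d"
  shows "linear (D2 c d p u)" "linear (\<lambda>u. D2 c d p u v)"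
proof -
  show 1: "linear (D2 c d p u)" for u using has_derivative_D2[OF assms] by (rule has_derivative_linear)
  \<comment> \<open>Linearity in the direction of the first derivative is borrowed from the second
    one by symmetry.\<close>
  show "linear (\<lambda>u. D2 c d p u v)" unfolding D2_symmetric[OF assms, of _ v] by (rule 1)
qed

text \<open>The derivative of the formula in \<open>transition_cot\<close>. The \<open>D2\<close>
  term arises because the point at which the inverse transition is differentiated moves with
  \<open>fst h\<close>.\<close>

definition Dcot :: "('a, real^'n) chart \<Rightarrow> ('a, real^'n) chart \<Rightarrow> 'a \<Rightarrow> real^'n \<Rightarrow>
    (real^'n) \<times> (real^'n) \<Rightarrow> (real^'n) \<times> (real^'n)" where
  "Dcot c d p a h = (D c d p (fst h),
     \<chi> i. snd h \<bullet> D d c p (axis i 1) + a \<bullet> D2 d c p (axis i 1) (D c d p (fst h)))"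

lemma has_derivative_cot:
  assumes c: "c \<in> A" "p \<in> fst c" and d: "d \<in> A" "p \<in> fst d"
  shows "(transition (cot c) (cot d) has_derivative Dcot c d p a) (at (snd c p, a))"
proof -
  let ?S = "\<lambda>i x. frechet_derivative (transition d c) (at x) (axis i 1)"
  let ?T = "\<lambda>w. (transition c d (fst w), \<chi> i. snd w \<bullet> ?S i (transition c d (fst w)))"
  have t: "((\<lambda>w. transition c d (fst w)) has_derivative (\<lambda>h. D c d p (fst h))) (at (snd c p, a))"
    by (rule has_derivative_compose[OF has_derivative_fst[OF has_derivative_ident]])
      (simp add: has_derivative_transition c d)
  have "((\<lambda>w. ?S i (transition c d (fst w))) has_derivative
      (\<lambda>h. D2 d c p (axis i 1) (D c d p (fst h)))) (at (snd c p, a))" for i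
    by (rule has_derivative_compose[OF t]) (simp add: transition c has_derivative_D2[OF d c])
  from has_derivative_inner[OF has_derivative_snd[OF has_derivative_ident] this]
  have "(?T has_derivative Dcot c d p a) (at (snd c p, a))"
    unfolding Dcot_def
    by (intro has_derivative_Pair t has_derivative_vec_lambda) (simp add: transition c add.commute)
  then show ?thesis
    by (rule has_derivative_transform_within_open[of _ _ _ _ "snd c ` (fst c \<inter> fst d) \<times> UNIV"])
      (use c d in \<open>auto intro!: open_Times open_overlap simp: transition transition_cot\<close>)
qed

lemma cotangent_differentiable_atlas: "differentiable_atlas (cotangent_atlas A)"
proof
  fix c' d' assume "c' \<in> cotangent_atlas A"
  then obtain c where c: "c \<in> A" "c' = cot c" by (auto simp: cotangent_atlas_def)
  show "inj_on (snd c') (fst c')" using c inj_cot by simp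
  assume "d' \<in> cotangent_atlas A"
  then obtain d where d: "d \<in> A" "d' = cot d" by (auto simp: cotangent_atlas_def)
  show "open (snd c' ` (fst c' \<inter> fst d'))" using c d by (simp add: image_cot open_Times open_overlap)
  fix z assume "z \<in> fst c'" "z \<in> fst d'"
  then show "transition c' d' differentiable at (snd c' z)"
    using has_derivative_cot[OF c(1) _ d(1)] c(2) d(2)
    by (cases z) (auto simp: fst_cot snd_cot differentiable_def)
qed

lemma D_inverse:
  assumes c: "c \<in> A" "p \<in> fst c" and d: "d \<in> A" "p \<in> fst d"
  shows "D d c p (D c d p y) = y"
  by (simp add: D_cocycle[OF c d c] D_id c)

text \<open>Invariance of the canonical symplectic form: each pairing acquires a term with the
  second derivative of the transition, and by symmetry the two terms cancel.\<close>

lemma Dcot_symplectic: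
  assumes c: "c \<in> A" "p \<in> fst c" and d: "d \<in> A" "p \<in> fst d"
  shows "snd (Dcot c d p a h) \<bullet> fst (Dcot c d p a k) - snd (Dcot c d p a k) \<bullet> fst (Dcot c d p a h)
    = snd h \<bullet> fst k - snd k \<bullet> fst h"
proof -
  let ?P = "D c d p" and ?S = "D d c p" and ?B = "D2 d c p"
  have *: "snd (Dcot c d p a h) \<bullet> fst (Dcot c d p a k)
      = snd h \<bullet> fst k + a \<bullet> ?B (?P (fst k)) (?P (fst h))" for h k
  proof -
    let ?y = "?P (fst k)"
    have "snd (Dcot c d p a h) \<bullet> fst (Dcot c d p a k)
        = (\<Sum>i\<in>UNIV. (snd h \<bullet> ?S (axis i 1) + a \<bullet> ?B (axis i 1) (?P (fst h))) * ?y $ i)"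
      by (simp add: Dcot_def inner_vec_def)
    also have "\<dots> = snd h \<bullet> (\<Sum>i\<in>UNIV. (?y $ i) *\<^sub>R ?S (axis i 1))
        + a \<bullet> (\<Sum>i\<in>UNIV. (?y $ i) *\<^sub>R ?B (axis i 1) (?P (fst h)))"
      by (simp add: inner_sum_right sum.distrib algebra_simps)
    also have "(\<Sum>i\<in>UNIV. (?y $ i) *\<^sub>R ?S (axis i 1)) = ?S ?y"
      using linear_vec_sum[OF linear_D[OF d(1) c(1) d(2) c(2)], of ?y] by simp
    also have "(\<Sum>i\<in>UNIV. (?y $ i) *\<^sub>R ?B (axis i 1) (?P (fst h))) = ?B ?y (?P (fst h))"
      using linear_vec_sum[OF linear_D2(2)[OF d c], of ?y "?P (fst h)"] by simp
    also have "?S ?y = fst k" by (rule D_inverse[OF c d])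
    finally show ?thesis .
  qed
  show ?thesis unfolding * using D2_symmetric[OF d c, of "?P (fst k)" "?P (fst h)"] by simp
qed

text \<open>\<open>v\<close> is the value at \<open>w\<close> of the Hamiltonian vector field of \<open>h\<close>.\<close>

definition hamiltonian_at ::
  "((real^'n) \<times> (real^'n) \<Rightarrow> real) \<Rightarrow> (real^'n) \<times> (real^'n) \<Rightarrow> (real^'n) \<times> (real^'n) \<Rightarrow> bool" where
  "hamiltonian_at h w v \<longleftrightarrow> (h has_derivative (\<lambda>k. snd k \<bullet> fst v - snd v \<bullet> fst k)) (at w)"

text \<open>Chain rule, invariance of the symplectic form and its nondegeneracy: the Hamiltonian
  vector of a function on the cotangent bundle does not depend on the chart.\<close>

lemma hamiltonian_at_cot:
  assumes c: "c \<in> A" "p \<in> fst c" and d: "d \<in> A" "p \<in> fst d"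
    and h: "hamiltonian_at (h \<circ> chart_inv (cot c)) (snd c p, a) v"
    and h': "hamiltonian_at (h \<circ> chart_inv (cot d)) (transition (cot c) (cot d) (snd c p, a)) v'"
  shows "v' = Dcot c d p a v"
proof -
  interpret cot: differentiable_atlas "cotangent_atlas A" by (rule cotangent_differentiable_atlas)
  let ?w = "(snd c p, a)" let ?T = "transition (cot c) (cot d)"
  let ?z = "(p, covec c p a)"
  have C: "cot c \<in> cotangent_atlas A" "cot d \<in> cotangent_atlas A"
    using c d by (auto simp: cotangent_atlas_def)
  have z: "?z \<in> fst (cot c)" "?z \<in> fst (cot d)" "snd (cot c) ?z = ?w"
    using c d covec[OF c, of a] by (auto simp: fst_cot snd_cot)
  let ?L = "\<lambda>v k. snd k \<bullet> fst v - snd v \<bullet> fst k"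
  have "((h \<circ> chart_inv (cot d)) \<circ> ?T has_derivative (?L v' \<circ> Dcot c d p a)) (at ?w)"
    by (rule diff_chain_at[OF has_derivative_cot[OF c d] h'[unfolded hamiltonian_at_def]])
  then have "(h \<circ> chart_inv (cot c) has_derivative (?L v' \<circ> Dcot c d p a)) (at ?w)"
  proof (rule has_derivative_transform_within_open[OF _ cot.open_overlap[OF C]])
    show "?w \<in> snd (cot c) ` (fst (cot c) \<inter> fst (cot d))" using z by (metis IntI imageI)
    fix x assume "x \<in> snd (cot c) ` (fst (cot c) \<inter> fst (cot d))"
    then show "(h \<circ> chart_inv (cot d) \<circ> ?T) x = (h \<circ> chart_inv (cot c)) x"
      by (auto simp del: split_paired_Ex simp: cot.transition C cot.chart_inv)
  qed
  then have "?L v' (Dcot c d p a k) = ?L v k" for k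
    using has_derivative_unique[OF _ h[unfolded hamiltonian_at_def]] unfolding o_def by meson
  then have eq: "?L v' (Dcot c d p a k) = ?L (Dcot c d p a v) (Dcot c d p a k)" for k
    using Dcot_symplectic[OF c d, of a k v] by simp
  \<comment> \<open>Nondegeneracy is applied with arbitrary test vectors \<open>b\<close>; the
    inverse transition shows that each of them is a value of \<open>Dcot c d p a\<close>.\<close>
  have surj: "\<exists>k. Dcot c d p a k = b" for b
  proof -
    have "cot.D (cot c) (cot d) ?z = Dcot c d p a"
      using has_derivative_cot[OF c d, of a] z(3) by (metis frechet_derivative_at)
    moreover have "cot.D (cot c) (cot d) ?z (cot.D (cot d) (cot c) ?z b) = b"
      using cot.D_cocycle[OF C(2) z(2) C(1) z(1) C(2) z(2)] cot.D_id[OF C(2) z(2)] by simp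
    ultimately show ?thesis by metis
  qed
  have eq': "?L v' b = ?L (Dcot c d p a v) b" for b using eq surj[of b] by metis
  have "b \<bullet> fst v' = b \<bullet> fst (Dcot c d p a v)" for b using eq'[of "(0, b)"] by simp
  moreover have "b \<bullet> snd v' = b \<bullet> snd (Dcot c d p a v)" for b using eq'[of "(b, 0)"] by (simp add: inner_commute)
  ultimately show ?thesis by (metis prod_eqI vector_eq_ldot)
qed

end

subsection \<open>The Hamiltonian of a trivialized Finsler structure\<close>

lemma asymmetric_norm_linear:
  assumes "asymmetric_norm V N" "linear L" "\<And>y. L y \<in> V" "\<And>y. L y = 0 \<Longrightarrow> y = 0"
  shows "asymmetric_norm UNIV (\<lambda>y. N (L y))"
  using assms(1,3,4) linear_0[OF assms(2)]
  unfolding asymmetric_norm_def linear_add[OF assms(2)] linear_cmul[OF assms(2)] by metis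

lemma vec_lambda_inner_linear:
  fixes l :: "real^'n \<Rightarrow> real"
  assumes "linear l"
  shows "(\<chi> k. l (axis k 1)) \<bullet> h = l h"
  using linear_vec_sum[OF assms, of h] by (simp add: inner_vec_def mult.commute)

locale geodesic_setting = smooth_atlas A
  for A :: "('a::{t2_space, second_countable_topology}, real^'n) chart set" +
  fixes F F' :: "'a \<times> ('a, real^'n) tvec \<Rightarrow> real"
    and U :: "'a set"
    and \<tau> :: "'a \<times> ('a, real^'n) tvec \<Rightarrow> 'a \<times> (real^'n)"
    and \<phi> :: "'a \<Rightarrow> real^'n"
    and G :: "(real^'n) \<times> (real^'n) \<Rightarrow> real"
  assumes F: "C0_Finsler A F"
    and F': "C0_Finsler A F'"
    and convex: "strongly_convex_wrt A F F'"
    and trivialization: "local_trivialization A U \<tau>"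
    and chart: "(U, \<phi>) \<in> A"
    and G_def: "G = F \<circ> the_inv_into (tangent_bundle A U) (map_prod \<phi> id \<circ> \<tau>)"
    and G_C1: "horizontally_C1 (\<phi> ` U) G"
    and G_lipschitz: "locally_lipschitz_on (\<phi> ` U \<times> UNIV) (horizontal_differential (\<lambda>z. (G z)\<^sup>2))"
begin

abbreviation "c0 \<equiv> (U, \<phi>)"

text \<open>The inverse of the trivialization on the fibre over \<open>p\<close>, and its matrix in a chart.\<close>

definition E :: "'a \<Rightarrow> real^'n \<Rightarrow> ('a, real^'n) tvec" where
  "E p y = snd (the_inv_into (tangent_bundle A U) \<tau> (p, y))"

definition B :: "('a, real^'n) chart \<Rightarrow> real^'n \<Rightarrow> real^'n \<Rightarrow> real^'n" where
  "B c x y = E (chart_inv c x) y c"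

lemma \<tau>_inv:
  assumes p: "p \<in> U"
  shows "the_inv_into (tangent_bundle A U) \<tau> (p, y) = (p, E p y)" "E p y \<in> tangent_space A p" "\<tau> (p, E p y) = (p, y)"
proof -
  let ?z = "the_inv_into (tangent_bundle A U) \<tau> (p, y)"
  have b: "inj_on \<tau> (tangent_bundle A U)" "\<tau> ` tangent_bundle A U = U \<times> UNIV"
    using trivialization by (simp_all add: local_trivialization_def bij_betw_def)
  have z: "?z \<in> tangent_bundle A U" "\<tau> ?z = (p, y)"
    using the_inv_into_into[OF b(1), of "(p, y)" "tangent_bundle A U"] f_the_inv_into_f[OF b(1), of "(p, y)"] p
    by (simp_all add: b(2))
  have "fst (\<tau> ?z) = fst ?z" using trivialization z(1) by (simp add: local_trivialization_def)
  then have "fst ?z = p" by (simp add: z(2))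
  then show 1: "?z = (p, E p y)" unfolding E_def by (metis prod.collapse)
  show "E p y \<in> tangent_space A p" "\<tau> (p, E p y) = (p, y)"
    using z unfolding 1 by (simp_all add: tangent_bundle_def)
qed

lemma E_\<tau>:
  assumes p: "p \<in> U" and v: "v \<in> tangent_space A p"
  shows "E p (snd (\<tau> (p, v))) = v"
proof -
  have "inj_on \<tau> (tangent_bundle A U)" "(p, v) \<in> tangent_bundle A U"
    using trivialization p v by (simp_all add: local_trivialization_def bij_betw_def tangent_bundle_def)
  moreover from this have "\<tau> (p, v) = (p, snd (\<tau> (p, v)))"
    using trivialization unfolding local_trivialization_def by (metis fst_conv prod.collapse)
  ultimately show ?thesis unfolding E_def using the_inv_into_f_f by (metis snd_conv)
qed

lemma \<tau>_linear:
  assumes "p \<in> U" "v \<in> tangent_space A p" "w \<in> tangent_space A p"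
  shows "snd (\<tau> (p, r *\<^sub>R v + s *\<^sub>R w)) = r *\<^sub>R snd (\<tau> (p, v)) + s *\<^sub>R snd (\<tau> (p, w))"
  using trivialization assms unfolding local_trivialization_def by blast

lemma E_linear:
  assumes p: "p \<in> U"
  shows "linear (E p)"
proof (rule linearI)
  fix x y r
  have "snd (\<tau> (p, 1 *\<^sub>R E p x + 1 *\<^sub>R E p y)) = x + y"
    unfolding \<tau>_linear[OF p \<tau>_inv(2)[OF p] \<tau>_inv(2)[OF p]] by (simp add: \<tau>_inv(3)[OF p])
  then show "E p (x + y) = E p x + E p y"
    using E_\<tau>[OF p tangent_space_scaleR_add[OF \<tau>_inv(2)[OF p] \<tau>_inv(2)[OF p]], of 1 x 1 y] by simp
  have "snd (\<tau> (p, r *\<^sub>R E p x + 0 *\<^sub>R E p x)) = r *\<^sub>R x"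
    unfolding \<tau>_linear[OF p \<tau>_inv(2)[OF p] \<tau>_inv(2)[OF p]] by (simp add: \<tau>_inv(3)[OF p])
  then show "E p (r *\<^sub>R x) = r *\<^sub>R E p x"
    using E_\<tau>[OF p tangent_space_scaleR_add[OF \<tau>_inv(2)[OF p] \<tau>_inv(2)[OF p]], of r x 0 x] by simp
qed

lemma E_eq_0: "p \<in> U \<Longrightarrow> E p y = 0 \<Longrightarrow> y = 0"
  by (metis \<tau>_inv(3) E_linear linear_0 snd_conv)

lemma chart_inv_c0: "p \<in> U \<Longrightarrow> chart_inv c0 (\<phi> p) = p"
  using chart_inv[OF chart, of p] by simp

lemma G_eq:
  assumes p: "p \<in> U"
  shows "G (\<phi> p, y) = F (p, E p y)"
proof -
  have "inj_on \<phi> U" using inj[OF chart] by simp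
  then have "inj_on (map_prod \<phi> id \<circ> \<tau>) (tangent_bundle A U)"
    using trivialization
    by (intro comp_inj_on) (auto simp: local_trivialization_def bij_betw_def inj_on_def)
  then have "the_inv_into (tangent_bundle A U) (map_prod \<phi> id \<circ> \<tau>) (\<phi> p, y) = (p, E p y)"
    by (rule the_inv_into_f_eq) (use p in \<open>auto simp: \<tau>_inv tangent_bundle_def\<close>)
  then show ?thesis by (simp add: G_def)
qed

lemma unit_sphere_iff:
  assumes p: "p \<in> U"
  shows "v \<in> unit_sphere A F p \<longleftrightarrow> (\<exists>r. v = E p r \<and> G (\<phi> p, r) = 1)"
  using E_\<tau>[OF p] \<tau>_inv(2)[OF p] unfolding unit_sphere_def G_eq[OF p] by (auto; metis)

context
  fixes c
  assumes c: "c \<in> A" "fst c \<subseteq> U"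
begin

lemma chart_point:
  assumes "x \<in> chart_image c"
  shows "chart_inv c x \<in> fst c" "chart_inv c x \<in> U" "snd c (chart_inv c x) = x"
proof -
  obtain p where "p \<in> fst c" "x = snd c p" using assms by (auto simp: chart_image_def)
  then show "chart_inv c x \<in> fst c" "chart_inv c x \<in> U" "snd c (chart_inv c x) = x"
    using c by (auto simp: chart_inv)
qed

text \<open>The inverse trivialization in coordinates, kept in the exact form of
  \<open>local_trivialization\<close> so that the smoothness clause there applies directly.\<close>

definition M :: "(real^'n) \<times> (real^'n) \<Rightarrow> (real^'n) \<times> (real^'n)" where
  "M = snd (tangent_chart A c) \<circ> the_inv_into (tangent_bundle A U) \<tau> \<circ> map_prod (chart_inv c) id"

definition DB :: "real^'n \<Rightarrow> real^'n \<Rightarrow> real^'n \<Rightarrow> real^'n" where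
  "DB x y h = snd (frechet_derivative M (at (x, y)) (h, 0))"

lemma M_smooth: "smooth_on (chart_image c \<times> UNIV) M"
  using trivialization c unfolding local_trivialization_def M_def by blast

lemma M_eq: "x \<in> chart_image c \<Longrightarrow> M (x, y) = (x, B c x y)"
  using chart_point[of x] by (simp add: M_def \<tau>_inv B_def tangent_chart_def)

lemma open_image: "open (chart_image c)" "open (chart_image c \<times> (UNIV :: (real^'n) set))"
  using chart_homeomorphism(2)[OF c(1)] by (simp_all add: open_Times)

lemma has_derivative_B:
  assumes "x \<in> chart_image c"
  shows "((\<lambda>x. B c x y) has_derivative DB x y) (at x)"
proof -
  have "(M has_derivative frechet_derivative M (at (x, y))) (at (x, y))"
    by (rule smooth_on_differentiable[OF M_smooth]) (use assms in simp)
  then have "((\<lambda>x. M (x, y)) has_derivative (\<lambda>h. frechet_derivative M (at (x, y)) (h, 0))) (at x)"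
    by (rule has_derivative_compose[rotated]) (auto intro!: derivative_eq_intros)
  then have "((\<lambda>x. snd (M (x, y))) has_derivative DB x y) (at x)"
    unfolding DB_def by (rule has_derivative_snd)
  then show ?thesis
    by (rule has_derivative_transform_within_open[OF _ open_image(1) assms]) (simp add: M_eq)
qed

lemma B_lipschitz: "locally_lipschitz_on (chart_image c \<times> UNIV) (\<lambda>(x, y). B c x y)"
proof -
  have "locally_lipschitz_on (chart_image c \<times> UNIV) (\<lambda>z. snd (M z))"
    by (intro locally_lipschitz_on_bounded_linear[OF bounded_linear_snd]
        smooth_on_imp_locally_lipschitz_on open_image M_smooth)
  then show ?thesis
    by (rule iffD1[OF locally_lipschitz_on_cong, rotated]) (auto simp: M_eq)
qed

lemma DB_lipschitz: "locally_lipschitz_on (chart_image c \<times> UNIV) (\<lambda>(x, y). DB x y h)"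
proof -
  have "locally_lipschitz_on (chart_image c \<times> UNIV) (\<lambda>z. snd (frechet_derivative M (at z) (h, 0)))"
    by (intro locally_lipschitz_on_bounded_linear[OF bounded_linear_snd]
        smooth_on_imp_locally_lipschitz_on open_image smooth_on_frechet_derivative M_smooth)
  then show ?thesis
    by (rule iffD1[OF locally_lipschitz_on_cong, rotated]) (auto simp: DB_def)
qed

lemma B_linear: "x \<in> chart_image c \<Longrightarrow> linear (B c x)"
  using E_linear[OF chart_point(2), of x] unfolding B_def
  by (intro linearI) (simp_all add: linear_add linear_cmul scaleR_fun_apply)

lemma B_E: "p \<in> fst c \<Longrightarrow> B c (snd c p) y = E p y c"
  using c by (simp add: B_def chart_inv)

lemma B_surj:
  assumes "x \<in> chart_image c"
  shows "\<exists>y. B c x y = v"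
proof -
  let ?p = "chart_inv c x"
  have "E ?p (snd (\<tau> (?p, coord_vector A c ?p v))) = coord_vector A c ?p v"
    by (intro E_\<tau> chart_point assms coord_vector c)
  then show ?thesis
    unfolding B_def using coord_vector(2)[OF c(1) chart_point(1)[OF assms]] by metis
qed

lemma B_eq_0:
  assumes "x \<in> chart_image c" "B c x y = 0"
  shows "y = 0"
proof -
  note p = chart_point[OF assms(1)]
  have "E (chart_inv c x) y = 0"
    by (rule tangent_space_eqI[OF c(1) p(1)])
      (use \<tau>_inv(2)[OF p(2)] assms(2) subspace_0[OF tangent_space_subspace] in \<open>simp_all add: B_def\<close>)
  then show ?thesis by (rule E_eq_0[OF p(2)])
qed

end

lemma c0: "c0 \<in> A" "fst c0 \<subseteq> U"
  using chart by auto

lemma chart_image_c0: "chart_image c0 = \<phi> ` U"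
  by (simp add: chart_image_def)

text \<open>\<open>F'\<close> read in the trivialization, as \<open>G\<close> is for
  \<open>F\<close>.\<close>

definition K :: "(real^'n) \<times> (real^'n) \<Rightarrow> real" where
  "K z = F' (chart_inv c0 (fst z), E (chart_inv c0 (fst z)) (snd z))"

sublocale cf: strongly_convex_family "\<phi> ` U" G K
proof
  show "open (\<phi> ` U)" using open_image(1)[OF c0] by (simp add: chart_image_c0)
  show "horizontally_C1 (\<phi> ` U) G" by (rule G_C1)
  show "locally_lipschitz_on (\<phi> ` U \<times> UNIV) (horizontal_differential (\<lambda>z. (G z)\<^sup>2))" by (rule G_lipschitz)
  have inj: "inj_on (snd (tangent_chart A c0)) (fst (tangent_chart A c0))"
  proof (rule inj_onI)
    fix z w
    assume "z \<in> fst (tangent_chart A c0)" "w \<in> fst (tangent_chart A c0)"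
      and eq: "snd (tangent_chart A c0) z = snd (tangent_chart A c0) w"
    then have *: "fst z \<in> U" "snd z \<in> tangent_space A (fst z)" "fst w \<in> U" "snd w \<in> tangent_space A (fst w)"
      "\<phi> (fst z) = \<phi> (fst w)" "snd z c0 = snd w c0"
      by (auto simp: tangent_chart_def tangent_bundle_def)
    then have "fst z = fst w" by (metis chart_inv_c0)
    then show "z = w" using tangent_space_eqI[OF c0(1), of "fst z" "snd z" "snd w"] *
      by (simp add: prod_eq_iff)
  qed
  have "K z = (F' \<circ> chart_inv (tangent_chart A c0)) (M c0 z)" if z: "z \<in> \<phi> ` U \<times> UNIV" for z
  proof -
    obtain p y where p: "p \<in> U" "z = (\<phi> p, y)" using z by auto
    have "M c0 z = (\<phi> p, E p y c0)" using M_eq[OF c0, of "\<phi> p" y] B_E[OF c0, of p y] p by (simp add: chart_image_c0)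
    moreover have "chart_inv (tangent_chart A c0) (\<phi> p, E p y c0) = (p, E p y)"
      unfolding chart_inv_def by (rule the_inv_into_f_eq[OF inj])
        (use p \<tau>_inv(2)[OF p(1)] in \<open>auto simp: tangent_chart_def tangent_bundle_def\<close>)
    ultimately show ?thesis using p by (simp add: K_def chart_inv_c0)
  qed
  moreover have "continuous_on (\<phi> ` U \<times> UNIV) (\<lambda>z. (F' \<circ> chart_inv (tangent_chart A c0)) (M c0 z))"
  proof (rule continuous_on_compose2[where f = "M c0"])
    show "continuous_on (\<phi> ` U \<times> UNIV) (F' \<circ> chart_inv (tangent_chart A c0))"
      using F' c0 unfolding C0_Finsler_def chart_image_c0[symmetric] by blast
    show "continuous_on (\<phi> ` U \<times> UNIV) (M c0)"
      using smooth_on_continuous[OF M_smooth[OF c0]] by (simp add: chart_image_c0)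
    show "M c0 ` (\<phi> ` U \<times> UNIV) \<subseteq> \<phi> ` U \<times> UNIV"
      using M_eq[OF c0] by (auto simp: chart_image_c0)
  qed
  ultimately show "continuous_on (\<phi> ` U \<times> UNIV) K" by (simp cong: continuous_on_cong)
  fix x assume "x \<in> \<phi> ` U"
  then obtain p where p: "p \<in> U" "x = \<phi> p" by auto
  have K: "K (x, y) = F' (p, E p y)" for y using p by (simp add: K_def chart_inv_c0)
  have "asymmetric_norm (tangent_space A p) (\<lambda>y. F' (p, y))" using F' by (simp add: C0_Finsler_def)
  then show "asymmetric_norm UNIV (\<lambda>y. K (x, y))"
    unfolding K by (rule asymmetric_norm_linear[OF _ E_linear[OF p(1)] \<tau>_inv(2)[OF p(1)] E_eq_0[OF p(1)]])
  fix y \<beta> z assume sub: "\<And>z. (G (x, z))\<^sup>2 \<ge> (G (x, y))\<^sup>2 + \<beta> \<bullet> (z - y)"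
  \<comment> \<open>The functional corresponding to \<open>\<beta>\<close> under the trivialization,
    0 elsewhere; through it a subgradient of the square of \<open>G\<close> becomes an element of
    the subdifferential of the square of \<open>F\<close>.\<close>
  define \<alpha> where "\<alpha> = (\<lambda>v. if v \<in> tangent_space A p then \<beta> \<bullet> snd (\<tau> (p, v)) else 0)"
  have \<alpha>_E: "\<alpha> (E p u) = \<beta> \<bullet> u" for u using \<tau>_inv[OF p(1)] by (simp add: \<alpha>_def)
  have E_all: "\<exists>u. v = E p u" if "v \<in> tangent_space A p" for v using E_\<tau>[OF p(1) that] by metis
  have "\<alpha> \<in> dual_space (tangent_space A p)"
    unfolding dual_space_def
  proof (intro CollectI conjI ballI allI impI)
    fix v w assume "v \<in> tangent_space A p" "w \<in> tangent_space A p"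
    then obtain a b where "v = E p a" "w = E p b" using E_all by blast
    then show "\<alpha> (v + w) = \<alpha> v + \<alpha> w"
      using \<alpha>_E by (simp add: linear_add[OF E_linear[OF p(1)], symmetric] inner_add_right)
  next
    fix r v assume "v \<in> tangent_space A p"
    then obtain a where "v = E p a" using E_all by blast
    then show "\<alpha> (r *\<^sub>R v) = r * \<alpha> v"
      using \<alpha>_E by (simp add: linear_cmul[OF E_linear[OF p(1)], symmetric])
  qed (simp add: \<alpha>_def)
  moreover have diff: "\<alpha> (E p u - E p y) = \<beta> \<bullet> (u - y)" for u
    using \<alpha>_E[of "u - y"] by (simp add: linear_diff[OF E_linear[OF p(1)]])
  moreover have "(F (p, v))\<^sup>2 \<ge> (F (p, E p y))\<^sup>2 + \<alpha> (v - E p y)" if "v \<in> tangent_space A p" for v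
  proof -
    from E_all[OF that] obtain u where "v = E p u" ..
    then show ?thesis using sub[of u] diff by (simp add: p G_eq)
  qed
  ultimately have "\<alpha> \<in> subdifferential (tangent_space A p) (\<lambda>v. (F (p, v))\<^sup>2) (E p y)"
    unfolding subdifferential_def by blast
  then have "(F (p, E p z))\<^sup>2 \<ge> (F (p, E p y))\<^sup>2 + \<alpha> (E p z - E p y) + (F' (p, E p z - E p y))\<^sup>2"
    using convex \<tau>_inv(2)[OF p(1)] unfolding strongly_convex_wrt_def by blast
  then show "(G (x, z))\<^sup>2 \<ge> (G (x, y))\<^sup>2 + \<beta> \<bullet> (z - y) + (K (x, z - y))\<^sup>2"
    unfolding K by (simp add: diff p G_eq linear_diff[OF E_linear[OF p(1)]])
qed

section \<open>The dual norm and its Hamiltonian vector field in a chart\<close>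

abbreviation "\<psi> c \<equiv> transition c c0"

text \<open>The components of a covector in the frame of the trivialization: the transpose of
  \<open>B\<close> applied to \<open>snd w\<close>.\<close>

definition \<beta> :: "('a, real^'n) chart \<Rightarrow> (real^'n) \<times> (real^'n) \<Rightarrow> real^'n" where
  "\<beta> c w = (\<chi> i. snd w \<bullet> B c (fst w) (axis i 1))"

definition \<xi> :: "('a, real^'n) chart \<Rightarrow> (real^'n) \<times> (real^'n) \<Rightarrow> real^'n" where
  "\<xi> c w = cf.legendre (\<psi> c (fst w)) (\<beta> c w)"

definition N :: "('a, real^'n) chart \<Rightarrow> (real^'n) \<times> (real^'n) \<Rightarrow> real" where
  "N c w = cf.dual_sq (\<psi> c (fst w)) (\<beta> c w)"

definition half_dN :: "('a, real^'n) chart \<Rightarrow> (real^'n) \<times> (real^'n) \<Rightarrow> real^'n \<Rightarrow> real" where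
  "half_dN c w h = (\<Sum>i\<in>UNIV. \<xi> c w $ i * (snd w \<bullet> DB c (fst w) (axis i 1) h)) +
     (- 1 / 2) * (cf.g (\<psi> c (fst w), \<xi> c w) \<bullet> frechet_derivative (\<psi> c) (at (fst w)) h)"

text \<open>\<open>H\<close> is the dual norm on the cotangent bundle, \<open>sqrt (N c w)\<close> its coordinate form and \<open>X c\<close> its
  Hamiltonian vector field in the chart \<open>c\<close>; \<open>half_dN c w h\<close> is half the derivative of \<open>N c\<close> at \<open>w\<close> in the
  direction \<open>(h, 0)\<close>.\<close>

definition H :: "'a \<times> ('a, real^'n) covec \<Rightarrow> real" where
  "H z = sqrt (cf.dual_sq (\<phi> (fst z)) (\<chi> i. snd z (E (fst z) (axis i 1))))"

definition X :: "('a, real^'n) chart \<Rightarrow> (real^'n) \<times> (real^'n) \<Rightarrow> (real^'n) \<times> (real^'n)" where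
  "X c w = (inverse (sqrt (N c w)) *\<^sub>R B c (fst w) (\<xi> c w),
     inverse (sqrt (N c w)) *\<^sub>R (\<chi> k. - half_dN c w (axis k 1)))"

context
  fixes c
  assumes c: "c \<in> A" "fst c \<subseteq> U"
begin

lemma \<psi>_eq: "\<psi> c x = \<phi> (chart_inv c x)"
  by (simp add: transition_def)

lemma \<psi>_in: "x \<in> chart_image c \<Longrightarrow> \<psi> c x \<in> \<phi> ` U"
  using chart_point(2)[OF c] by (simp add: \<psi>_eq)

lemma \<psi>_smooth: "smooth_on (chart_image c) (\<psi> c)"
  using smooth_transition[OF c(1) c0(1)] c(2) by (simp add: chart_image_def Int_absorb2)

lemma \<psi>_has_derivative: "x \<in> chart_image c \<Longrightarrow> (\<psi> c has_derivative frechet_derivative (\<psi> c) (at x)) (at x)"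
  by (rule smooth_on_differentiable[OF \<psi>_smooth])

lemma \<beta>_inner:
  assumes "fst w \<in> chart_image c"
  shows "\<beta> c w \<bullet> y = snd w \<bullet> B c (fst w) y"
  unfolding \<beta>_def using linear_compose[OF B_linear[OF c assms] bounded_linear.linear[OF bounded_linear_inner_right, of "snd w"]]
  by (intro vec_lambda_inner_linear) (simp add: o_def)

lemma \<beta>_nonzero:
  assumes "fst w \<in> chart_image c" "snd w \<noteq> 0"
  shows "\<beta> c w \<noteq> 0"
proof -
  obtain y where "B c (fst w) y = snd w" using B_surj[OF c assms(1)] by blast
  then show ?thesis using \<beta>_inner[OF assms(1), of y] assms(2) by auto
qed

lemma N_pos: "fst w \<in> chart_image c \<Longrightarrow> snd w \<noteq> 0 \<Longrightarrow> 0 < N c w"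
  unfolding N_def by (intro cf.dual_sq_pos \<psi>_in \<beta>_nonzero)

text \<open>\<open>H\<close> is defined without reference to \<open>c\<close>; this makes the
  vectors \<open>X c\<close> for different charts comparable by
  \<open>hamiltonian_at_cot\<close>.\<close>

lemma H_eq:
  assumes "fst w \<in> chart_image c"
  shows "(H \<circ> chart_inv (cot c)) w = sqrt (N c w)"
proof -
  note p = chart_point[OF c assms]
  have "chart_inv (cot c) w = (chart_inv c (fst w), covec c (chart_inv c (fst w)) (snd w))"
    using chart_inv_cot[OF c(1) assms, of "snd w"] by simp
  then show ?thesis
    using \<tau>_inv(2)[OF p(2)] by (simp add: H_def N_def \<psi>_eq \<beta>_def covec_def B_def)
qed

lemma half_dN_linear:
  assumes "fst w \<in> chart_image c"
  shows "linear (half_dN c w)"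
proof -
  have "linear (DB c (fst w) y)" for y using has_derivative_linear[OF has_derivative_B[OF c assms]] .
  moreover have "linear (frechet_derivative (\<psi> c) (at (fst w)))"
    using has_derivative_linear[OF \<psi>_has_derivative[OF assms]] .
  ultimately show ?thesis
    unfolding half_dN_def
    by (intro linearI)
      (simp_all add: linear_add linear_cmul inner_add_right sum.distrib sum_distrib_left algebra_simps)
qed

text \<open>The base point acts in two ways: through the coordinate change \<open>\<psi> c\<close>,
  which meets \<open>cf.g\<close>, and through the frame \<open>B\<close>, which moves
  \<open>\<beta> c w\<close> and contributes the \<open>DB\<close> terms.\<close>

lemma has_derivative_N:
  assumes w: "fst w \<in> chart_image c"
  shows "(N c has_derivative (\<lambda>h. 2 * (snd h \<bullet> B c (fst w) (\<xi> c w) + half_dN c w (fst h)))) (at w)"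
proof -
  let ?x = "fst w" and ?a = "snd w"
  have fst: "(fst has_derivative fst) (at w)" and snd: "(snd has_derivative snd) (at w)"
    using has_derivative_fst[OF has_derivative_ident] has_derivative_snd[OF has_derivative_ident] by auto
  have \<psi>: "((\<lambda>w. \<psi> c (fst w)) has_derivative (\<lambda>h. frechet_derivative (\<psi> c) (at ?x) (fst h))) (at w)"
    by (rule has_derivative_compose[OF fst \<psi>_has_derivative[OF w]])
  have "((\<lambda>w. B c (fst w) (axis i 1)) has_derivative (\<lambda>h. DB c ?x (axis i 1) (fst h))) (at w)" for i
    by (rule has_derivative_compose[OF fst has_derivative_B[OF c w]])
  from has_derivative_inner[OF snd this]
  have \<beta>: "(\<beta> c has_derivative (\<lambda>h. \<chi> i. ?a \<bullet> DB c ?x (axis i 1) (fst h) + snd h \<bullet> B c ?x (axis i 1))) (at w)"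
    (is "(_ has_derivative ?D\<beta>) _")
    unfolding \<beta>_def by (rule has_derivative_vec_lambda)
  have "((\<lambda>z. cf.dual_sq (fst z) (snd z)) has_derivative
    (\<lambda>h. 2 * (\<xi> c w \<bullet> snd h) - cf.g (\<psi> c ?x, \<xi> c w) \<bullet> fst h)) (at (\<psi> c ?x, \<beta> c w))"
    unfolding \<xi>_def by (rule cf.has_derivative_dual_sq[OF \<psi>_in[OF w]])
  from has_derivative_compose[OF has_derivative_Pair[OF \<psi> \<beta>] this]
  have "(N c has_derivative (\<lambda>h. 2 * (\<xi> c w \<bullet> ?D\<beta> h)
      - cf.g (\<psi> c ?x, \<xi> c w) \<bullet> frechet_derivative (\<psi> c) (at ?x) (fst h))) (at w)"
    by (simp add: N_def[abs_def])
  moreover have "\<xi> c w \<bullet> ?D\<beta> h = snd h \<bullet> B c ?x (\<xi> c w) + (\<Sum>i\<in>UNIV. \<xi> c w $ i * (?a \<bullet> DB c ?x (axis i 1) (fst h)))" for h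
    unfolding linear_vec_sum[OF B_linear[OF c w], of "\<xi> c w"]
    by (simp add: inner_vec_def[of "\<xi> c w"] inner_sum_right sum.distrib algebra_simps)
  ultimately show ?thesis by (simp add: half_dN_def add_diff_eq)
qed

text \<open>\<open>N\<close> is positive off the zero section, so its root is differentiable there;
  the factor 2 in the derivative of \<open>N\<close> cancels against the one from the root.\<close>

lemma hamiltonian_at_X:
  assumes w: "fst w \<in> chart_image c" "snd w \<noteq> 0"
  shows "hamiltonian_at (H \<circ> chart_inv (cot c)) w (X c w)"
proof -
  have eq: "(\<chi> k. - half_dN c w (axis k 1)) \<bullet> h = - half_dN c w h" for h
    using vec_lambda_inner_linear[OF linear_compose_neg[OF half_dN_linear[OF w(1)]]] by simp
  have "((\<lambda>w. sqrt (N c w)) has_derivative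
      (\<lambda>h. 2 * (snd h \<bullet> B c (fst w) (\<xi> c w) + half_dN c w (fst h)) * (inverse (sqrt (N c w)) / 2))) (at w)"
    using has_derivative_real_sqrt[OF N_pos[OF w] has_derivative_N[OF w(1)]] by simp
  then have "((\<lambda>w. sqrt (N c w)) has_derivative (\<lambda>k. snd k \<bullet> fst (X c w) - snd (X c w) \<bullet> fst k)) (at w)"
    by (simp add: X_def eq algebra_simps)
  then show ?thesis
    unfolding hamiltonian_at_def
    by (rule has_derivative_transform_within_open[OF _ open_image(2)[OF c]])
      (use w H_eq in \<open>auto simp: mem_Times_iff\<close>)
qed

lemma X_lipschitz: "locally_lipschitz_on (chart_image c \<times> (UNIV - {0})) (X c)"
proof -
  let ?S = "chart_image c \<times> (UNIV - {0 :: real^'n})"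
  have fst: "locally_lipschitz_on ?S fst" and snd: "locally_lipschitz_on ?S snd"
    by (rule locally_lipschitz_on_bounded_linear[OF _ locally_lipschitz_on_ident];
        simp add: bounded_linear_fst bounded_linear_snd)+
  have \<psi>: "locally_lipschitz_on ?S (\<lambda>w. \<psi> c (fst w))"
    by (rule locally_lipschitz_on_compose[OF fst smooth_on_imp_locally_lipschitz_on[OF open_image(1)[OF c] \<psi>_smooth]]) auto
  have D\<psi>: "locally_lipschitz_on ?S (\<lambda>w. frechet_derivative (\<psi> c) (at (fst w)) h)" for h
    by (rule locally_lipschitz_on_compose[OF fst smooth_on_imp_locally_lipschitz_on[OF open_image(1)[OF c]
            smooth_on_frechet_derivative[OF \<psi>_smooth]]]) auto
  have B: "locally_lipschitz_on ?S (\<lambda>w. B c (fst w) (y w))" if "locally_lipschitz_on ?S y" for y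
    using locally_lipschitz_on_compose[OF locally_lipschitz_on_Pair[OF fst that] B_lipschitz[OF c]] by (auto simp: image_subset_iff)
  have DB: "locally_lipschitz_on ?S (\<lambda>w. DB c (fst w) y h)" for y h
    using locally_lipschitz_on_compose[OF locally_lipschitz_on_Pair[OF fst locally_lipschitz_on_const] DB_lipschitz[OF c]]
    by (auto simp: image_subset_iff)
  have \<beta>: "locally_lipschitz_on ?S (\<beta> c)"
    unfolding \<beta>_def by (intro locally_lipschitz_on_vec_lambda locally_lipschitz_on_inner snd B locally_lipschitz_on_const)
  have \<xi>: "locally_lipschitz_on ?S (\<xi> c)"
    unfolding \<xi>_def using locally_lipschitz_on_compose[OF locally_lipschitz_on_Pair[OF \<psi> \<beta>] cf.legendre_lipschitz]
    by (auto simp: \<psi>_in image_subset_iff)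
  have g: "locally_lipschitz_on ?S (\<lambda>w. cf.g (\<psi> c (fst w), \<xi> c w))"
    by (rule locally_lipschitz_on_compose[OF locally_lipschitz_on_Pair[OF \<psi> \<xi>] cf.lipschitz]) (auto simp: \<psi>_in)
  have s: "locally_lipschitz_on ?S (\<lambda>w. inverse (sqrt (N c w)))"
  proof (rule locally_lipschitz_on_inverse_sqrt)
    show "locally_lipschitz_on ?S (N c)"
      unfolding N_def cf.dual_sq_def \<xi>_def[symmetric] by (intro locally_lipschitz_on_inner \<beta> \<xi>)
  qed (auto intro!: N_pos)
  have nth: "locally_lipschitz_on ?S (\<lambda>w. \<xi> c w $ i)" for i
    by (rule locally_lipschitz_on_bounded_linear[OF bounded_linear_vec_nth \<xi>])
  have l: "locally_lipschitz_on ?S (\<lambda>w. half_dN c w h)" for h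
    unfolding half_dN_def
    by (intro locally_lipschitz_on_add locally_lipschitz_on_sum locally_lipschitz_on_mult locally_lipschitz_on_inner
        nth snd DB locally_lipschitz_on_const g D\<psi>)
  have "locally_lipschitz_on ?S (\<lambda>w. (inverse (sqrt (N c w)) *\<^sub>R B c (fst w) (\<xi> c w),
     inverse (sqrt (N c w)) *\<^sub>R (\<chi> k. - half_dN c w (axis k 1))))"
    by (intro locally_lipschitz_on_Pair locally_lipschitz_on_scaleR s B \<xi> locally_lipschitz_on_vec_lambda
        locally_lipschitz_on_bounded_linear[OF bounded_linear_minus[OF bounded_linear_ident]] l)
  then show ?thesis unfolding X_def[abs_def] .
qed

lemma pontryagin_hamiltonian:
  assumes p: "p \<in> fst c" and \<alpha>: "\<alpha> \<in> dual_space (tangent_space A p)" "\<alpha> \<noteq> 0"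
    and f: "pontryagin_family A F c f" and u: "u \<in> sphere 0 1"
    and max: "\<And>v. v \<in> sphere 0 1 \<Longrightarrow> hamiltonian A c f v (p, \<alpha>) \<le> hamiltonian A c f u (p, \<alpha>)"
  shows "hamiltonian_vector A c f u (p, \<alpha>) =
    coord_vector (cotangent_atlas A) (cot c) (p, \<alpha>) (X c (snd (cot c) (p, \<alpha>)))"
proof -
  define x where "x = snd c p"
  define a where "a = covec_coords A c p \<alpha>"
  let ?w = "(x, a)"
  let ?H = "H \<circ> chart_inv (cot c)"
  have x: "x \<in> chart_image c" "chart_inv c x = p" using p c(1) by (auto simp: x_def chart_image_def chart_inv)
  have a0: "a \<noteq> 0" unfolding a_def by (rule covec_coords_nonzero[OF c(1) p \<alpha>])
  have sphere: "f (snd c q) ` sphere 0 1 = (\<lambda>y. y c) ` unit_sphere A F q" if "q \<in> fst c" for q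
    using f that unfolding pontryagin_family_def homeomorphism_def by metis
  define k where "k = (\<lambda>w. snd w \<bullet> f (fst w) u)"
  \<comment> \<open>With \<open>u\<close> fixed, \<open>f (fst w) u\<close> is a unit vector over
    every base point of the chart, so its pairing with a covector is at most the dual norm.\<close>
  have le: "k w \<le> ?H w" if w: "fst w \<in> chart_image c" for w
  proof -
    let ?q = "chart_inv c (fst w)"
    note q = chart_point[OF c w]
    have "f (fst w) u \<in> (\<lambda>y. y c) ` unit_sphere A F ?q" using sphere[OF q(1)] q(3) u by auto
    then obtain r where r: "f (fst w) u = E ?q r c" "G (\<phi> ?q, r) = 1"
      using unit_sphere_iff[OF q(2)] by auto
    have "k w = \<beta> c w \<bullet> r" using \<beta>_inner[OF w] r(1) by (simp add: k_def B_def)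
    also have "\<dots> \<le> sqrt (N c w)"
      unfolding N_def by (rule cf.inner_le_dual[OF \<psi>_in[OF w]]) (simp add: \<psi>_eq r)
    finally show ?thesis using H_eq[OF w] by simp
  qed
  have ham: "hamiltonian A c f v (p, \<alpha>) = a \<bullet> f x v" for v
    using covec_inner[OF c(1) p \<alpha>(1) coord_vector(1)[OF c(1) p]]
    by (simp add: hamiltonian_def coord_vector[OF c(1) p] a_def x_def)
  \<comment> \<open>Some unit vector attains the dual norm; it is \<open>f x v\<close> for some
    \<open>v\<close>, and its value is dominated by that of the maximizer \<open>u\<close>.\<close>
  have eq: "k ?w = ?H ?w"
  proof (rule antisym[OF le])
    obtain r where r: "G (\<psi> c x, r) = 1" "\<beta> c ?w \<bullet> r = sqrt (N c ?w)"
      using cf.dual_attained[OF \<psi>_in[OF x(1)] \<beta>_nonzero[of ?w]] x a0 by (auto simp: N_def)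
    have "E p r \<in> unit_sphere A F p" using unit_sphere_iff[of p "E p r"] r(1) p c(2) by (auto simp: \<psi>_eq x)
    then have "E p r c \<in> f x ` sphere 0 1" using sphere[OF p] by (simp add: x_def)
    then obtain v where v: "v \<in> sphere 0 1" "E p r c = f x v" by blast
    have "?H ?w = a \<bullet> f x v" using H_eq[of ?w] \<beta>_inner[of ?w r] r(2) x v(2) by (simp add: B_def)
    also have "\<dots> \<le> a \<bullet> f x u" using max[OF v(1)] by (simp add: ham)
    finally show "?H ?w \<le> k ?w" by (simp add: k_def)
  qed (simp add: x)
  let ?f' = "frechet_derivative (\<lambda>x. f x u) (at x)"
  have f': "((\<lambda>x. f x u) has_derivative ?f') (at x)"
    using f u x(1) by (auto simp: pontryagin_family_def frechet_derivative_works)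
  have k': "(k has_derivative (\<lambda>h. a \<bullet> ?f' (fst h) + snd h \<bullet> f x u)) (at ?w)"
  proof -
    have "((\<lambda>w. f (fst w) u) has_derivative (\<lambda>h. ?f' (fst h))) (at ?w)"
      by (rule has_derivative_compose[OF has_derivative_fst[OF has_derivative_ident]]) (simp add: f')
    from has_derivative_inner[OF has_derivative_snd[OF has_derivative_ident] this]
    show ?thesis by (simp add: k_def)
  qed
  let ?L = "\<lambda>v k. snd k \<bullet> fst v - snd v \<bullet> fst k"
  have "((\<lambda>w. ?H w - k w) has_derivative (\<lambda>h. ?L (X c ?w) h - (a \<bullet> ?f' (fst h) + snd h \<bullet> f x u))) (at ?w)"
    by (rule has_derivative_diff[OF hamiltonian_at_X[unfolded hamiltonian_at_def] k']) (use x(1) a0 in auto)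
  \<comment> \<open>The difference is nonnegative over the chart and vanishes at \<open>?w\<close>,
    which is therefore a minimum.\<close>
  then have zero: "(\<lambda>h. ?L (X c ?w) h - (a \<bullet> ?f' (fst h) + snd h \<bullet> f x u)) = (\<lambda>h. 0)"
    by (rule differential_zero_maxmin[of ?w "chart_image c \<times> UNIV", rotated 2])
      (use x(1) open_image(2)[OF c] le eq in \<open>auto simp: mem_Times_iff\<close>)
  have L: "?L (X c ?w) h = a \<bullet> ?f' (fst h) + snd h \<bullet> f x u" for h
    using fun_cong[OF zero, of h] by linarith
  have "b \<bullet> fst (X c ?w) = b \<bullet> f x u" for b
    using L[of "(0, b)"] linear_0[OF has_derivative_linear[OF f']] by simp
  then have 1: "fst (X c ?w) = f x u" by (metis vector_eq_ldot)
  have 2: "snd (X c ?w) $ i = - (\<Sum>j\<in>UNIV. a $ j * partial i (\<lambda>x. f x u $ j) x)" for i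
  proof -
    have "partial i (\<lambda>x. f x u $ j) x = ?f' (axis i 1) $ j" for j
      by (rule has_derivative_imp_partial) (rule bounded_linear.has_derivative[OF bounded_linear_vec_nth f'])
    then show ?thesis using L[of "(axis i 1, 0)"] by (simp add: inner_axis inner_vec_def[of a])
  qed
  have "X c ?w = (f x u, \<chi> i. - (\<Sum>j\<in>UNIV. a $ j * partial i (\<lambda>x. f x u $ j) x))"
    using 1 2 by (simp add: prod_eq_iff vec_eq_iff)
  then show ?thesis by (simp add: hamiltonian_vector_def snd_cot x_def a_def)
qed

end

text \<open>Constant vectors of the trivialization, normalized by \<open>F\<close>: the Pontryagin
  family that makes the extended geodesic field nonempty.\<close>

definition field :: "real^'n \<Rightarrow> real^'n \<Rightarrow> real^'n" where
  "field x u = inverse (G (x, u)) *\<^sub>R B c0 x u"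

definition Dfield :: "real^'n \<Rightarrow> real^'n \<Rightarrow> real^'n \<Rightarrow> real^'n" where
  "Dfield x u h = inverse (G (x, u)) *\<^sub>R DB c0 x u h +
     (- (inverse (G (x, u)) * (\<Sum>i\<in>UNIV. h $ i * hpartial i G (x, u)) * inverse (G (x, u)))) *\<^sub>R B c0 x u"

lemma has_derivative_field:
  assumes x: "x \<in> chart_image c0" and u: "u \<noteq> 0"
  shows "((\<lambda>x. field x u) has_derivative Dfield x u) (at x)"
proof -
  have xW: "x \<in> \<phi> ` U" using x by (simp add: chart_image_c0)
  have "G (x, u) \<noteq> 0" using cf.G_eq_0[OF xW] u by simp
  from has_derivative_scaleR[OF Deriv.has_derivative_inverse[OF this cf.has_derivative_G[OF xW]] has_derivative_B[OF c0 x]]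
  show ?thesis unfolding field_def Dfield_def by simp
qed

lemma continuous_on_field:
  "continuous_on (chart_image c0 \<times> sphere 0 1) (\<lambda>(x, u). field x u)" (is ?C)
  "continuous_on (chart_image c0 \<times> sphere 0 1) (\<lambda>(x, u). Dfield x u h)" (is ?D)
proof -
  let ?S = "chart_image c0 \<times> sphere (0 :: real^'n) 1"
  have sub: "?S \<subseteq> chart_image c0 \<times> UNIV" by auto
  have G: "continuous_on ?S (\<lambda>z. G (fst z, snd z))"
    using continuous_on_subset[OF cf.G_cont, of ?S] by (auto simp: chart_image_c0)
  have G0: "\<forall>z\<in>?S. G (fst z, snd z) \<noteq> 0"
    using cf.G_eq_0 by (fastforce simp: chart_image_c0)
  have hp: "continuous_on ?S (\<lambda>z. hpartial i G (fst z, snd z))" for i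
  proof -
    have "continuous_on (\<phi> ` U \<times> UNIV) (hpartial i G)" using G_C1 by (simp add: horizontally_C1_def)
    from continuous_on_subset[OF this, of ?S] show ?thesis by (auto simp: chart_image_c0)
  qed
  have B: "continuous_on ?S (\<lambda>z. B c0 (fst z) (snd z))"
    using continuous_on_subset[OF locally_lipschitz_on_imp_continuous_on[OF B_lipschitz[OF c0]] sub]
    by (simp add: case_prod_beta)
  have DB: "continuous_on ?S (\<lambda>z. DB c0 (fst z) (snd z) h)"
    using continuous_on_subset[OF locally_lipschitz_on_imp_continuous_on[OF DB_lipschitz[OF c0]] sub]
    by (simp add: case_prod_beta)
  show ?C unfolding field_def case_prod_beta by (intro continuous_intros G G0 B)
  show ?D unfolding Dfield_def case_prod_beta by (intro continuous_intros G G0 B DB hp)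
qed

lemma field_homeomorphism:
  assumes p: "p \<in> U"
  shows "\<exists>g. homeomorphism (sphere 0 1) ((\<lambda>y. y c0) ` unit_sphere A F p) (field (\<phi> p)) g"
proof (rule homeomorphism_compact)
  let ?x = "\<phi> p"
  have x: "?x \<in> chart_image c0" "?x \<in> \<phi> ` U" using p by (simp_all add: chart_image_c0)
  have field_B: "field ?x u = B c0 ?x (inverse (G (?x, u)) *\<^sub>R u)" for u
    by (simp add: field_def linear_cmul[OF B_linear[OF c0 x(1)]])
  have B_p: "B c0 ?x r = E p r c0" for r using p by (simp add: B_def chart_inv_c0)
  show "compact (sphere (0 :: real^'n) 1)" by simp
  show "continuous_on (sphere 0 1) (field ?x)"
  proof -
    have "continuous_on (sphere 0 1) (\<lambda>u :: real^'n. (?x, u))" by (intro continuous_intros)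
    from continuous_on_compose2[OF continuous_on_field(1) this] x show ?thesis by (simp add: image_subset_iff)
  qed
  show "field ?x ` sphere 0 1 = (\<lambda>y. y c0) ` unit_sphere A F p"
  proof (intro equalityI subsetI)
    fix v assume "v \<in> field ?x ` sphere 0 1"
    then obtain u where u: "norm u = 1" "v = field ?x u" by auto
    have "G (?x, u) > 0" using u(1) by (intro cf.G_pos x) auto
    then have "G (?x, inverse (G (?x, u)) *\<^sub>R u) = 1" by (simp add: cf.G_scale x)
    then have "E p (inverse (G (?x, u)) *\<^sub>R u) \<in> unit_sphere A F p" using unit_sphere_iff[OF p] by auto
    then show "v \<in> (\<lambda>y. y c0) ` unit_sphere A F p" by (auto simp: u field_B B_p)
  next
    fix v assume "v \<in> (\<lambda>y. y c0) ` unit_sphere A F p"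
    then obtain r where r: "v = E p r c0" "G (?x, r) = 1" using unit_sphere_iff[OF p] by auto
    have "r \<noteq> 0" using r(2) cf.G_eq_0[OF x(2), of 0] by auto
    \<comment> \<open>\<open>field\<close> normalizes along rays only, so the Euclidean direction of
      \<open>r\<close> is the preimage.\<close>
    then have "v = field ?x ((1 / norm r) *\<^sub>R r)" using r by (simp add: field_B B_p cf.G_scale x)
    then show "v \<in> field ?x ` sphere 0 1" using \<open>r \<noteq> 0\<close> by (intro image_eqI) auto
  qed
  show "inj_on (field ?x) (sphere 0 1)"
  proof (rule inj_onI)
    fix u w :: "real^'n" assume *: "u \<in> sphere 0 1" "w \<in> sphere 0 1" "field ?x u = field ?x w"
    then have n: "norm u = 1" "norm w = 1" by auto
    have pos: "G (?x, u) > 0" "G (?x, w) > 0" using n by (auto intro!: cf.G_pos x)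
    have "B c0 ?x (inverse (G (?x, u)) *\<^sub>R u - inverse (G (?x, w)) *\<^sub>R w) = 0"
      using *(3) by (simp add: field_B linear_diff[OF B_linear[OF c0 x(1)]])
    from B_eq_0[OF c0 x(1) this] have eq: "inverse (G (?x, u)) *\<^sub>R u = inverse (G (?x, w)) *\<^sub>R w" by simp
    \<comment> \<open>Since \<open>u\<close> and \<open>w\<close> have Euclidean norm 1, the norms
      recover the two scale factors.\<close>
    then have "norm (inverse (G (?x, u)) *\<^sub>R u) = norm (inverse (G (?x, w)) *\<^sub>R w)" by simp
    then have "G (?x, u) = G (?x, w)" using n pos by simp
    with eq pos show "u = w" by simp
  qed
qed

lemma field_pontryagin: "pontryagin_family A F c0 field"
  unfolding pontryagin_family_def
proof (intro conjI ballI allI)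
  fix u :: "real^'n" assume u: "u \<in> sphere 0 1"
  then have u0: "u \<noteq> 0" by auto
  have D: "frechet_derivative (\<lambda>x. field x u) (at x) = Dfield x u" if "x \<in> chart_image c0" for x
    using frechet_derivative_at[OF has_derivative_field[OF that u0]] by simp
  have "continuous_on (chart_image c0) (\<lambda>x. (x, u))" by (intro continuous_intros)
  from continuous_on_compose2[OF continuous_on_field(2) this] u
  have "continuous_on (chart_image c0) (\<lambda>x. Dfield x u v)" for v
    by (simp add: image_subset_iff)
  then have "continuous_on (chart_image c0) (\<lambda>x. frechet_derivative (\<lambda>x. field x u) (at x) v)" for v
    by (simp add: D cong: continuous_on_cong)
  moreover have "\<forall>x\<in>chart_image c0. (\<lambda>x. field x u) differentiable (at x)"
    using has_derivative_field[OF _ u0] differentiableI by blast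
  ultimately show "Ck_on 1 (chart_image c0) (\<lambda>x. field x u)" by simp
next
  fix p assume "p \<in> fst c0"
  then show "\<exists>g. homeomorphism (sphere 0 1) ((\<lambda>y. y c0) ` unit_sphere A F p) (field (snd c0 p)) g"
    using field_homeomorphism by simp
next
  show "continuous_on (chart_image c0 \<times> sphere 0 1) (\<lambda>(x, u). field x u)" by (rule continuous_on_field)
next
  fix i
  have "(\<chi> j. partial i (\<lambda>x. field x u $ j) x) = Dfield x u (axis i 1)"
    if "x \<in> chart_image c0" "u \<in> sphere 0 1" for x u
  proof -
    have "u \<noteq> 0" using that by auto
    from has_derivative_imp_partial[OF bounded_linear.has_derivative[OF bounded_linear_vec_nth has_derivative_field[OF that(1) this]]]
    show ?thesis by (simp add: vec_eq_iff)
  qed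
  then show "continuous_on (chart_image c0 \<times> sphere 0 1) (\<lambda>(x, u). \<chi> j. partial i (\<lambda>x. field x u $ j) x)"
    using continuous_on_field(2)[of "axis i 1"]
    by (rule_tac iffD2[OF continuous_on_cong[OF refl]]) auto
qed

section \<open>The extended geodesic field as a Hamiltonian vector field\<close>

definition geodesic_vector ::
  "'a \<times> ('a, real^'n) covec \<Rightarrow> ('a \<times> ('a, real^'n) covec, (real^'n) \<times> (real^'n)) tvec" where
  "geodesic_vector z = coord_vector (cotangent_atlas A) (cot c0) z (X c0 (snd (cot c0) z))"

text \<open>\<open>X c0\<close> and \<open>X c\<close> are Hamiltonian vectors of the same
  \<open>H\<close> at the same covector, so \<open>hamiltonian_at_cot\<close> identifies them as
  components of one tangent vector.\<close>

lemma geodesic_vector_coord: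
  assumes c: "c \<in> A" "fst c \<subseteq> U" "p \<in> fst c" and \<alpha>: "\<alpha> \<in> dual_space (tangent_space A p)" "\<alpha> \<noteq> 0"
  shows "geodesic_vector (p, \<alpha>) \<in> tangent_space (cotangent_atlas A) (p, \<alpha>)"
    "geodesic_vector (p, \<alpha>) (cot c) = X c (snd (cot c) (p, \<alpha>))"
    "coord_vector (cotangent_atlas A) (cot c) (p, \<alpha>) (X c (snd (cot c) (p, \<alpha>))) = geodesic_vector (p, \<alpha>)"
proof -
  interpret cot: differentiable_atlas "cotangent_atlas A" by (rule cotangent_differentiable_atlas)
  let ?z = "(p, \<alpha>)"
  have p0: "p \<in> fst c0" using c by auto
  have C: "cot c0 \<in> cotangent_atlas A" "?z \<in> fst (cot c0)" "cot c \<in> cotangent_atlas A" "?z \<in> fst (cot c)"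
    using c c0(1) p0 \<alpha>(1) by (auto simp: cotangent_atlas_def fst_cot)
  have X: "hamiltonian_at (H \<circ> chart_inv (cot d)) (snd (cot d) ?z) (X d (snd (cot d) ?z))"
    if "d \<in> A" "fst d \<subseteq> U" "p \<in> fst d" for d
    by (rule hamiltonian_at_X) (use that covec_coords_nonzero[OF _ _ \<alpha>] in \<open>auto simp: snd_cot chart_image_def\<close>)
  show 1: "geodesic_vector ?z \<in> tangent_space (cotangent_atlas A) ?z"
    unfolding geodesic_vector_def by (rule cot.coord_vector(1)[OF C(1,2)])
  have t: "snd (cot c) ?z = transition (cot c0) (cot c) (snd c0 p, covec_coords A c0 p \<alpha>)"
    using cot.transition[OF C(1,2), of "cot c"] by (simp add: snd_cot)
  have "X c (snd (cot c) ?z) = Dcot c0 c p (covec_coords A c0 p \<alpha>) (X c0 (snd (cot c0) ?z))"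
  proof (rule hamiltonian_at_cot[OF c0(1) p0 c(1,3)])
    show "hamiltonian_at (H \<circ> chart_inv (cot c0)) (snd c0 p, covec_coords A c0 p \<alpha>) (X c0 (snd (cot c0) ?z))"
      using X[OF c0 p0] by (simp add: snd_cot)
    show "hamiltonian_at (H \<circ> chart_inv (cot c)) (transition (cot c0) (cot c) (snd c0 p, covec_coords A c0 p \<alpha>))
        (X c (snd (cot c) ?z))"
      using X[OF c] unfolding t .
  qed
  also have "\<dots> = cot.D (cot c0) (cot c) ?z (X c0 (snd (cot c0) ?z))"
    using frechet_derivative_at[OF has_derivative_cot[OF c0(1) p0 c(1,3)]] by (simp add: snd_cot)
  also have "\<dots> = geodesic_vector ?z (cot c)"
    using cot.tangent_space_D[OF 1 C] by (simp add: geodesic_vector_def cot.coord_vector(2)[OF C(1,2)])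
  finally show 2: "geodesic_vector ?z (cot c) = X c (snd (cot c) ?z)" ..
  show "coord_vector (cotangent_atlas A) (cot c) ?z (X c (snd (cot c) ?z)) = geodesic_vector ?z"
    using cot.coord_vector(3)[OF C(3,4) 1] unfolding 2 .
qed

text \<open>Every family in every admissible chart yields \<open>geodesic_vector\<close>, by
  \<open>pontryagin_hamiltonian\<close>. An element exists because \<open>field\<close> is such a
  family; its maximizer is the parameter of a unit vector attaining the dual norm.\<close>

lemma extended_geodesic_field_eq:
  assumes p: "p \<in> U" and \<alpha>: "\<alpha> \<in> dual_space (tangent_space A p)" "\<alpha> \<noteq> 0"
  shows "extended_geodesic_field A U F (p, \<alpha>) = {geodesic_vector (p, \<alpha>)}"
proof -
  have *: "hamiltonian_vector A c f u (p, \<alpha>) = geodesic_vector (p, \<alpha>)"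
    if "c \<in> A" "fst c \<subseteq> U" "p \<in> fst c" "pontryagin_family A F c f" "u \<in> sphere 0 1"
      "\<forall>v\<in>sphere 0 1. hamiltonian A c f v (p, \<alpha>) \<le> hamiltonian A c f u (p, \<alpha>)" for c f u
    using pontryagin_hamiltonian[OF that(1-3) \<alpha> that(4,5)] geodesic_vector_coord(3)[OF that(1-3) \<alpha>] that(6)
    by simp
  have p0: "p \<in> fst c0" using p by simp
  let ?a = "covec_coords A c0 p \<alpha>"
  let ?w = "(\<phi> p, ?a)"
  have x: "\<phi> p \<in> chart_image c0" using p by (simp add: chart_image_c0)
  have xW: "\<phi> p \<in> \<phi> ` U" using p by simp
  have a0: "?a \<noteq> 0" by (rule covec_coords_nonzero[OF c0(1) p0 \<alpha>])
  have b0: "\<beta> c0 ?w \<noteq> 0" using \<beta>_nonzero[OF c0, of ?w] x a0 by simp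
  have onto: "field (\<phi> p) ` sphere 0 1 = (\<lambda>y. y c0) ` unit_sphere A F p"
    using field_homeomorphism[OF p] unfolding homeomorphism_def by blast
  have ham: "hamiltonian A c0 field v (p, \<alpha>) = ?a \<bullet> field (\<phi> p) v" for v
    using covec_inner[OF c0(1) p0 \<alpha>(1) coord_vector(1)[OF c0(1) p0]]
    by (simp add: hamiltonian_def coord_vector[OF c0(1) p0])
  have inner: "?a \<bullet> E p r c0 = \<beta> c0 ?w \<bullet> r" for r
    using \<beta>_inner[OF c0, of ?w r] x by (simp add: B_def chart_inv_c0 p)
  obtain r where r: "G (\<phi> p, r) = 1" "\<beta> c0 ?w \<bullet> r = sqrt (cf.dual_sq (\<phi> p) (\<beta> c0 ?w))"
    using cf.dual_attained[OF xW b0] by blast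
  have "E p r c0 \<in> field (\<phi> p) ` sphere 0 1" unfolding onto using unit_sphere_iff[OF p] r(1) by blast
  then obtain u where u: "u \<in> sphere 0 1" "field (\<phi> p) u = E p r c0" by auto
  have "hamiltonian A c0 field v (p, \<alpha>) \<le> hamiltonian A c0 field u (p, \<alpha>)" if v: "v \<in> sphere 0 1" for v
  proof -
    have "field (\<phi> p) v \<in> (\<lambda>y. y c0) ` unit_sphere A F p" using onto v by blast
    then obtain s where "field (\<phi> p) v = E p s c0" "G (\<phi> p, s) = 1" using unit_sphere_iff[OF p] by auto
    then show ?thesis using cf.inner_le_dual[OF xW, of s "\<beta> c0 ?w"] by (simp add: ham u inner r)
  qed
  then have mem: "hamiltonian_vector A c0 field u (p, \<alpha>) \<in> extended_geodesic_field A U F (p, \<alpha>)"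
    unfolding extended_geodesic_field_def using c0 p0 field_pontryagin u(1) by fastforce
  have uniq: "\<xi> = geodesic_vector (p, \<alpha>)" if "\<xi> \<in> extended_geodesic_field A U F (p, \<alpha>)" for \<xi>
    using that unfolding extended_geodesic_field_def mem_Collect_eq by (elim exE conjE) (simp add: *)
  show ?thesis
  proof (rule equalityI)
    show "extended_geodesic_field A U F (p, \<alpha>) \<subseteq> {geodesic_vector (p, \<alpha>)}"
      by (rule subsetI) (simp only: singleton_iff uniq)
    show "{geodesic_vector (p, \<alpha>)} \<subseteq> extended_geodesic_field A U F (p, \<alpha>)"
      using mem uniq[OF mem] by simp
  qed
qed

lemma locally_lipschitz_geodesic_field:
  "locally_lipschitz_vector_field A U (extended_geodesic_field A U F)"
  unfolding locally_lipschitz_vector_field_def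
proof (intro conjI ballI impI)
  fix z assume "z \<in> slit_cotangent_bundle A U"
  then obtain p \<alpha> where z: "z = (p, \<alpha>)" "p \<in> U" "\<alpha> \<in> dual_space (tangent_space A p)" "\<alpha> \<noteq> 0"
    by (auto simp: slit_cotangent_bundle_def cotangent_bundle_def)
  show "\<exists>\<xi>\<in>tangent_space (cotangent_atlas A) z. extended_geodesic_field A U F z = {\<xi>}"
    using geodesic_vector_coord(1)[OF c0 _ z(3,4)] extended_geodesic_field_eq[OF z(2-4)] z(1,2) by auto
next
  fix c assume c: "c \<in> A" "fst c \<subseteq> U"
  have "the_elem (extended_geodesic_field A U F (chart_inv (cot c) w)) (cot c) = X c w"
    if w: "w \<in> chart_image c \<times> (UNIV - {0})" for w
  proof -
    obtain x a where xa: "w = (x, a)" "x \<in> chart_image c" "a \<noteq> 0" using w by auto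
    let ?p = "chart_inv c x"
    note p = chart_point[OF c xa(2)]
    note cov = covec[OF c(1) p(1), of a]
    have "covec c ?p a \<noteq> 0"
    proof
      assume 0: "covec c ?p a = 0"
      have "a = 0" using cov(2) unfolding 0 by (simp add: covec_coords_def vec_eq_iff)
      then show False using xa(3) by simp
    qed
    note eq = extended_geodesic_field_eq[OF p(2) cov(1) this] geodesic_vector_coord(2)[OF c p(1) cov(1) this]
    show ?thesis using eq by (simp add: xa chart_inv_cot[OF c(1)] snd_cot cov(2) p(3))
  qed
  note eq = this
  show "locally_lipschitz_on (chart_image c \<times> (UNIV - {0}))
      (\<lambda>w. the_elem (extended_geodesic_field A U F (chart_inv (cot c) w)) (cot c))"
    by (rule iffD2[OF locally_lipschitz_on_cong X_lipschitz[OF c]]) (rule eq)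
qed

end

theorem theorem7p4:
  fixes A :: "('a::{t2_space, second_countable_topology}, real^'n) chart set"
    and F F' :: "'a \<times> ('a, real^'n) tvec \<Rightarrow> real"
    and U :: "'a set"
    and \<tau> :: "'a \<times> ('a, real^'n) tvec \<Rightarrow> 'a \<times> (real^'n)"
    and \<phi> :: "'a \<Rightarrow> real^'n"
    and F\<^sub>\<tau> :: "(real^'n) \<times> (real^'n) \<Rightarrow> real"
  assumes "smooth_manifold A"
    and "C0_Finsler A F"
    and "Finsler A F'"
    and "strongly_convex_wrt A F F'"
    and "open U"
    and "local_trivialization A U \<tau>"
    and "(U, \<phi>) \<in> A"
    and "F\<^sub>\<tau> = F \<circ> the_inv_into (tangent_bundle A U) (map_prod \<phi> id \<circ> \<tau>)"
    and "horizontally_C2 (\<phi> ` U) F\<^sub>\<tau>"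
    and "locally_lipschitz_on (\<phi> ` U \<times> UNIV) (horizontal_differential (\<lambda>z. (F\<^sub>\<tau> z)\<^sup>2))"
  shows "locally_lipschitz_vector_field A U (extended_geodesic_field A U F)"
proof -
  interpret geodesic_setting A F F' U \<tau> \<phi> F\<^sub>\<tau>
    by unfold_locales (use assms in \<open>auto simp: Finsler_def horizontally_C2_def\<close>)
  show ?thesis by (rule locally_lipschitz_geodesic_field)
qed

end
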